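(* Let $\xi=(\xi_i)_{i\in\mathbb{Z}}$ be the $\{0,1\}$-valued process with skeleton sequence $S=(S_k)_{k\ge0}$ constructed in the context. Then $\xi$ is stationary, the $\sigma$-algebra $\sigma(S)$ generated by $S$ is a factor $\sigma$-algebra of $\xi$, and $\xi$ is 2-fold mixing but not 3-fold mixing relatively to $\sigma(S)$.
   Context: Block laws. For each $k\ge0$ let $\mu_k$ be the probability measure on $\{0,1\}^{3^k}$ defined inductively as follows: $\mu_0$ is the uniform measure on $\{0,1\}$, and $\mu_{k+1}$ is the law of the concatenation $(U,V,U+V)$, where $U,V$ are independent with law $\mu_k$ and $U+V$ is the coordinatewise sum mod 2. Construction of $\xi$. Let $S=(S_k)_{k\ge0}$ be a sequence of independent random variables uniformly distributed on $\{0,1,2\}$ (the skeleton sequence). Put $N_k=\sum_{j=0}^{k-1}S_j3^j$ and let $I_k=\{-N_k,-N_k+1,\ldots,-N_k+3^k-1\}$ be the position of the $k$-block containing coordinate $0$; thus $I_k\subset I_{k+1}$ is the first, second or third third of $I_{k+1}$ according to whether $S_k=0,1,2$. Almost surely $\bigcup_k I_k=\mathbb{Z}$. Conditionally on $S$, the law of $\xi$ is the one for which, for every $k\ge0$, the tuple $(\xi_i)_{i\in I_k}$ has law $\mu_k$. (Equivalently: $\xi_0$ is a fair coin toss independent of $S$; given the $k$-block on $I_k$, among the two other $k$-blocks of $I_{k+1}$ the first missing one is chosen independently with law $\mu_k$, and the last one is the coordinatewise sum mod 2 of the two others.) Stationarity means that the law of $\xi$ is invariant under the shift $T:(x_i)_{i\in\mathbb{Z}}\mapsto(x_{i+1})_{i\in\mathbb{Z}}$.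 A factor $\sigma$-algebra of $\xi$ is a $\sigma$-algebra that, up to null sets, is a shift-invariant sub-$\sigma$-algebra of $\sigma(\xi)$; in particular $S$ is then almost surely equal to a measurable function of $\xi$. Relative mixing. Write $\xi_i^j=(\xi_i,\ldots,\xi_j)$. Let $\mathcal{F}$ be a factor $\sigma$-algebra of $\xi$. The process $\xi$ is 2-fold mixing relatively to $\mathcal{F}$ if for all $\ell\ge0$ and all $E_1,E_2\subset\{0,1\}^{\ell+1}$, $$\mathbb{P}(\xi_0^\ell\in E_1,\ \xi_p^{p+\ell}\in E_2\mid\mathcal{F})-\mathbb{P}(\xi_0^\ell\in E_1\mid\mathcal{F})\,\mathbb{P}(\xi_p^{p+\ell}\in E_2\mid\mathcal{F})\longrightarrow0$$ in probability as $p\to+\infty$. It is 3-fold mixing relatively to $\mathcal{F}$ if for all $\ell\ge0$ and all $E_1,E_2,E_3\subset\{0,1\}^{\ell+1}$, $$\mathbb{P}(\xi_0^\ell\in E_1,\ \xi_p^{p+\ell}\in E_2,\ \xi_{p+q}^{p+q+\ell}\in E_3\mid\mathcal{F})-\mathbb{P}(\xi_0^\ell\in E_1\mid\mathcal{F})\,\mathbb{P}(\xi_p^{p+\ell}\in E_2\mid\mathcal{F})\,\mathbb{P}(\xi_{p+q}^{p+q+\ell}\in E_3\mid\mathcal{F})\longrightarrow0$$ in probability as $p$ and $q$ both tend to $+\infty$. *)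

theory Defs
  imports "HOL-Probability.Probability" "HOL-Library.Z2"
begin

text \<open>The alphabet is the two-element field \<open>bit\<close>, whose addition is addition mod 2.
  Words are lists, so an element of $\{0,1\}^n$ is a \<open>bit list\<close> of length \<open>n\<close>.\<close>

primrec block_law :: "nat \<Rightarrow> bit list pmf" where
  "block_law 0 = map_pmf (\<lambda>b. [b]) (pmf_of_set {0, 1})"
| "block_law (Suc k) =
     map_pmf (\<lambda>(U, V). U @ V @ map2 (+) U V) (pair_pmf (block_law k) (block_law k))"

text \<open>\<open>segment X i j\<close> is the word $(X_i,\ldots,X_j)$.\<close>

definition segment :: "(int \<Rightarrow> 'a \<Rightarrow> bit) \<Rightarrow> int \<Rightarrow> int \<Rightarrow> 'a \<Rightarrow> bit list" where
  "segment X i j \<omega> = map (\<lambda>n. X n \<omega>) [i..j]"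

definition block_offset :: "(nat \<Rightarrow> 'a \<Rightarrow> nat) \<Rightarrow> nat \<Rightarrow> 'a \<Rightarrow> int" where
  "block_offset S k \<omega> = (\<Sum>j<k. int (S j \<omega>) * 3 ^ j)"

text \<open>The word read on the random interval $I_k = \{-N_k,\ldots,-N_k+3^k-1\}$.\<close>

definition block_word :: "(nat \<Rightarrow> 'a \<Rightarrow> nat) \<Rightarrow> (int \<Rightarrow> 'a \<Rightarrow> bit) \<Rightarrow> nat \<Rightarrow> 'a \<Rightarrow> bit list" where
  "block_word S X k \<omega> =
     segment X (- block_offset S k \<omega>) (- block_offset S k \<omega> + 3 ^ k - 1) \<omega>"

definition skeleton_algebra :: "'a measure \<Rightarrow> (nat \<Rightarrow> 'a \<Rightarrow> nat) \<Rightarrow> 'a measure" where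
  "skeleton_algebra M S =
     vimage_algebra (space M) (\<lambda>\<omega> k. S k \<omega>) (Pi\<^sub>M UNIV (\<lambda>_. count_space UNIV))"

text \<open>A version of the conditional probability of the event \<open>A\<close> given the sub-\<open>\<sigma>\<close>-algebra \<open>F\<close>.\<close>

definition prob_given :: "'a measure \<Rightarrow> 'a measure \<Rightarrow> 'a set \<Rightarrow> 'a \<Rightarrow> real" where
  "prob_given M F A = real_cond_exp M F (indicator A)"

locale skeleton_process = prob_space M
  for M :: "'a measure" and S :: "nat \<Rightarrow> 'a \<Rightarrow> nat" and X :: "int \<Rightarrow> 'a \<Rightarrow> bit" +
  assumes S_indep: "indep_vars (\<lambda>_. count_space UNIV) S UNIV"
    and S_uniform: "\<And>k. distr M (count_space UNIV) (S k) = measure_pmf (pmf_of_set {0, 1, 2})"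
    and X_measurable: "\<And>i. X i \<in> measurable M (count_space UNIV)"
    and block_cond_law: "\<And>k w. AE \<omega> in M.
      prob_given M (skeleton_algebra M S) {\<omega> \<in> space M. block_word S X k \<omega> = w} \<omega>
        = pmf (block_law k) w"

definition seq_space :: "(int \<Rightarrow> bit) measure" where
  "seq_space = Pi\<^sub>M UNIV (\<lambda>_. count_space UNIV)"

definition shift :: "(int \<Rightarrow> bit) \<Rightarrow> (int \<Rightarrow> bit)" where
  "shift x = (\<lambda>i. x (i + 1))"

definition process_law :: "'a measure \<Rightarrow> (int \<Rightarrow> 'a \<Rightarrow> bit) \<Rightarrow> (int \<Rightarrow> bit) measure" where
  "process_law M X = distr M seq_space (\<lambda>\<omega> i. X i \<omega>)"

definition stationary :: "'a measure \<Rightarrow> (int \<Rightarrow> 'a \<Rightarrow> bit) \<Rightarrow> bool" where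
  "stationary M X \<longleftrightarrow> distr (process_law M X) seq_space shift = process_law M X"

text \<open>The shift acts on sequences and not on \<open>M\<close>: up to null sets, \<open>F\<close> is the preimage under the
  process of a \<open>\<sigma>\<close>-algebra \<open>G\<close> on sequences. As the shift is invertible, invariance
  of \<open>G\<close> means equality with its preimage, not mere inclusion.\<close>

definition factor_algebra :: "'a measure \<Rightarrow> (int \<Rightarrow> 'a \<Rightarrow> bit) \<Rightarrow> 'a measure \<Rightarrow> bool" where
  "factor_algebra M X F \<longleftrightarrow> subalgebra M F \<and>
     (\<exists>G. subalgebra seq_space G \<and>
        (\<lambda>B. shift -` B) ` sets G = sets G \<and>
        (\<forall>A\<in>sets F. \<exists>B\<in>sets G. AE \<omega> in M. \<omega> \<in> A \<longleftrightarrow> (\<lambda>i. X i \<omega>) \<in> B) \<and>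
        (\<forall>B\<in>sets G. \<exists>A\<in>sets F. AE \<omega> in M. \<omega> \<in> A \<longleftrightarrow> (\<lambda>i. X i \<omega>) \<in> B))"

definition tendsto_zero_in_prob :: "'a measure \<Rightarrow> ('b \<Rightarrow> 'a \<Rightarrow> real) \<Rightarrow> 'b filter \<Rightarrow> bool" where
  "tendsto_zero_in_prob M Y L \<longleftrightarrow>
     (\<forall>\<epsilon>>0. ((\<lambda>n. measure M {\<omega> \<in> space M. \<bar>Y n \<omega>\<bar> > \<epsilon>}) \<longlongrightarrow> 0) L)"

definition segment_event ::
  "'a measure \<Rightarrow> (int \<Rightarrow> 'a \<Rightarrow> bit) \<Rightarrow> nat \<Rightarrow> nat \<Rightarrow> bit list set \<Rightarrow> 'a set" where
  "segment_event M X l p E = {\<omega> \<in> space M. segment X (int p) (int (p + l)) \<omega> \<in> E}"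

definition mixing2_relative :: "'a measure \<Rightarrow> (int \<Rightarrow> 'a \<Rightarrow> bit) \<Rightarrow> 'a measure \<Rightarrow> bool" where
  "mixing2_relative M X F \<longleftrightarrow>
     (\<forall>l E1 E2. E1 \<subseteq> {w. length w = l + 1} \<longrightarrow> E2 \<subseteq> {w. length w = l + 1} \<longrightarrow>
        tendsto_zero_in_prob M
          (\<lambda>p \<omega>. prob_given M F (segment_event M X l 0 E1 \<inter> segment_event M X l p E2) \<omega>
             - prob_given M F (segment_event M X l 0 E1) \<omega>
               * prob_given M F (segment_event M X l p E2) \<omega>)
          sequentially)"

definition mixing3_relative :: "'a measure \<Rightarrow> (int \<Rightarrow> 'a \<Rightarrow> bit) \<Rightarrow> 'a measure \<Rightarrow> bool" where
  "mixing3_relative M X F \<longleftrightarrow>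
     (\<forall>l E1 E2 E3. E1 \<subseteq> {w. length w = l + 1} \<longrightarrow> E2 \<subseteq> {w. length w = l + 1} \<longrightarrow>
        E3 \<subseteq> {w. length w = l + 1} \<longrightarrow>
        tendsto_zero_in_prob M
          (\<lambda>(p, q) \<omega>. prob_given M F (segment_event M X l 0 E1 \<inter> segment_event M X l p E2
                                      \<inter> segment_event M X l (p + q) E3) \<omega>
             - prob_given M F (segment_event M X l 0 E1) \<omega>
               * prob_given M F (segment_event M X l p E2) \<omega>
               * prob_given M F (segment_event M X l (p + q) E3) \<omega>)
          (sequentially \<times>\<^sub>F sequentially))"

end

theory Submission
  imports Defs "HOL-Real_Asymp.Real_Asymp"
begin

text \<open>
  The law \<open>\<mu>\<^sub>k\<close> is invariant under translation by words of its support, so any two of the blocks \<open>U\<close>, \<open>V\<close>,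
  \<open>U + V\<close> are independent with law \<open>\<mu>\<^sub>k\<close>; by induction any two distinct \<open>k\<close>-blocks inside a larger block are
  independent. Given the skeleton, two windows far apart lie in distinct \<open>k\<close>-blocks unless one of them
  straddles a boundary between \<open>k\<close>-blocks, which has probability at most \<open>2 l / 3\<^sup>k\<close>: this is 2-fold mixing. On
  \<open>S\<^sub>k = 0\<close> the coordinates \<open>0\<close>, \<open>3\<^sup>k\<close>, \<open>2 \<cdot> 3\<^sup>k\<close> are pairwise independent fair bits with sum \<open>0\<close>, which
  contradicts 3-fold mixing.

  Stationarity holds since the offset of \<open>0\<close> in its \<open>k\<close>-block is uniform, so that moving it by one changes the
  law of a window by \<open>O(3\<^sup>-\<^sup>k)\<close>.

  The skeleton is recovered from the process one level at a time: the sums of the first letters of three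
  successive \<open>k\<close>-blocks vanish along the true grid of \<open>(k + 1)\<close>-blocks. Along a wrong grid this has probability
  \<open>p\<^sub>r\<close> inside a \<open>(k + r)\<close>-block with \<open>p\<^sub>r\<^sub>+\<^sub>1 \<le> p\<^sub>r\<^sup>2\<close> and \<open>p\<^sub>2 < 1\<close>, so it almost surely fails. The events
  that the sums vanish along the grid through \<open>- n\<close> for all levels below \<open>k\<close> are permuted by the shift, hence they
  generate a shift-invariant \<open>\<sigma>\<close>-algebra.
\<close>

section \<open>Block laws\<close>

declare add_bit_eq_xor [simp del]

lemma length_block_law: "w \<in> set_pmf (block_law k) \<Longrightarrow> length w = 3 ^ k"
  by (induction k arbitrary: w) auto

text \<open>The index counts aligned blocks from \<open>0\<close>, so for a subblock of a larger
  block its base-3 digits name the successive thirds that contain it.\<close>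

definition block :: "nat \<Rightarrow> nat \<Rightarrow> 'b list \<Rightarrow> 'b list" where
  "block k a w = take (3 ^ k) (drop (a * 3 ^ k) w)"

lemma map2_add_append:
  "length u = length v \<Longrightarrow> map2 (+) (u @ u') (v @ v') = map2 (+) u v @ map2 (+) u' v'"
  by simp

text \<open>This makes translation respect the third block: translating \<open>U\<close> and
  \<open>V\<close> by \<open>a\<close> and \<open>b\<close> translates \<open>U + V\<close> by
  \<open>a + b\<close>.\<close>

lemma map2_add_exchange:
  fixes u v x y :: "'b::ab_semigroup_add list"
  assumes "length u = n" "length v = n" "length x = n" "length y = n"
  shows "map2 (+) (map2 (+) u v) (map2 (+) x y) = map2 (+) (map2 (+) u x) (map2 (+) v y)"
  using assms by (intro nth_equalityI) (auto simp: ac_simps)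

lemma map2_add_commute: "map2 (+) u v = map2 (+) v (u :: 'b::ab_semigroup_add list)"
  by (induction u v rule: list_induct2') (auto simp: ac_simps)

text \<open>A word of the support has the form \<open>(a, b, a + b)\<close>. Adding it to
  \<open>(U, V, U + V)\<close> amounts to translating the independent words \<open>U\<close> and
  \<open>V\<close> by \<open>a\<close> and \<open>b\<close>, to which the induction hypothesis
  applies separately.\<close>

lemma translate_block_law:
  "u \<in> set_pmf (block_law k) \<Longrightarrow> map_pmf (map2 (+) u) (block_law k) = block_law k"
proof (induction k arbitrary: u)
  case 0
  have *: "bij_betw ((+) (hd u)) {0, 1::bit} {0, 1}"
    by (rule bij_betwI[where g = "(+) (hd u)"]) (auto simp: add.assoc[symmetric] intro: bit_not_one_iff)
  have u: "u = [hd u]"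
    using 0 by auto
  have "map_pmf (map2 (+) u) (block_law 0) = map_pmf (\<lambda>b. [hd u + b]) (pmf_of_set {0, 1})"
    by (subst u) (simp add: map_pmf_comp)
  also have "\<dots> = map_pmf (\<lambda>b. [b]) (map_pmf ((+) (hd u)) (pmf_of_set {0, 1}))"
    by (simp add: map_pmf_comp)
  also have "map_pmf ((+) (hd u)) (pmf_of_set {0, 1}) = pmf_of_set {0, 1}"
    using * by (intro map_pmf_of_set_bij_betw) auto
  finally show ?case by simp
next
  case (Suc k)
  then obtain a b where ab: "a \<in> set_pmf (block_law k)" "b \<in> set_pmf (block_law k)"
    and u: "u = a @ b @ map2 (+) a b"
    by auto
  note len = length_block_law[OF ab(1)] length_block_law[OF ab(2)]
  let ?c = "\<lambda>(U, V). U @ V @ map2 (+) U V"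
  have "map_pmf (map2 (+) u) (block_law (Suc k)) =
    map_pmf ?c (map_pmf (\<lambda>(x, y). (map2 (+) a x, map2 (+) b y)) (pair_pmf (block_law k) (block_law k)))"
    using len unfolding block_law.simps map_pmf_comp
    by (intro map_pmf_cong refl)
      (auto simp: u map2_add_append map2_add_exchange[where n = "3 ^ k"] dest!: length_block_law)
  also have "\<dots> = block_law (Suc k)"
    by (simp add: map_pair Suc.IH ab)
  finally show ?case .
qed

text \<open>Conditionally on \<open>U\<close>, the word \<open>U + V\<close> is a translate of
  \<open>V\<close> by a word of the support, so its conditional law does not depend on
  \<open>U\<close>.\<close>

lemma pair_add_block_law:
  "map_pmf (\<lambda>(U, V). (U, map2 (+) U V)) (pair_pmf (block_law k) (block_law k))
    = pair_pmf (block_law k) (block_law k)"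
proof -
  have "map_pmf (\<lambda>(U, V). (U, map2 (+) U V)) (pair_pmf (block_law k) (block_law k)) =
    bind_pmf (block_law k) (\<lambda>U. map_pmf (Pair U) (map_pmf (map2 (+) U) (block_law k)))"
    by (simp add: pair_pmf_def map_bind_pmf map_pmf_def bind_assoc_pmf bind_return_pmf)
  also have "\<dots> = bind_pmf (block_law k) (\<lambda>U. map_pmf (Pair U) (block_law k))"
    by (intro bind_pmf_cong) (auto simp: translate_block_law)
  also have "\<dots> = pair_pmf (block_law k) (block_law k)"
    by (simp add: pair_pmf_def map_pmf_def)
  finally show ?thesis .
qed

lemma pair_add_block_law':
  "map_pmf (\<lambda>(U, V). (V, map2 (+) U V)) (pair_pmf (block_law k) (block_law k))
    = pair_pmf (block_law k) (block_law k)"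
proof -
  have "map_pmf (\<lambda>(U, V). (V, map2 (+) U V)) (pair_pmf (block_law k) (block_law k)) =
    map_pmf (\<lambda>(U, V). (U, map2 (+) U V)) (map_pmf (\<lambda>(x, y). (y, x)) (pair_pmf (block_law k) (block_law k)))"
    by (auto simp: map_pmf_comp map2_add_commute intro!: map_pmf_cong)
  also have "map_pmf (\<lambda>(x, y). (y, x)) (pair_pmf (block_law k) (block_law k)) =
      pair_pmf (block_law k) (block_law k)"
    by (rule pair_commute_pmf[symmetric])
  finally show ?thesis by (simp only: pair_add_block_law)
qed

section \<open>Laws of subblocks and of pairs of subblocks\<close>

lemma block_concat3:
  assumes "length U = 3 ^ k" "length V = 3 ^ k" "length W = 3 ^ k"
  shows "block k 0 (U @ V @ W) = U" "block k (Suc 0) (U @ V @ W) = V" "block k 2 (U @ V @ W) = W"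
  using assms by (auto simp: block_def)

lemma swap_pair_pmf_eq:
  "map_pmf (\<lambda>w. (f w, g w)) p = pair_pmf q q \<Longrightarrow> map_pmf (\<lambda>w. (g w, f w)) p = pair_pmf q q"
proof -
  assume *: "map_pmf (\<lambda>w. (f w, g w)) p = pair_pmf q q"
  have "map_pmf (\<lambda>w. (g w, f w)) p = map_pmf (\<lambda>(x, y). (y, x)) (map_pmf (\<lambda>w. (f w, g w)) p)"
    by (simp add: map_pmf_comp)
  also have "\<dots> = pair_pmf q q"
    unfolding * by (rule pair_commute_pmf[symmetric])
  finally show ?thesis .
qed

text \<open>The pair \<open>(0, 1)\<close> is the construction itself, \<open>(0, 2)\<close> and
  \<open>(1, 2)\<close> are \<open>pair_add_block_law\<close> and its primed companion, and
  exchanging coordinates covers the other three.\<close>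

lemma thirds_law:
  assumes "s < 3" "t < 3" "s \<noteq> t"
  shows "map_pmf (\<lambda>w. (block k s w, block k t w)) (block_law (Suc k))
    = pair_pmf (block_law k) (block_law k)" (is "?P s t")
proof -
  have "?P 0 1"
    unfolding block_law.simps map_pmf_comp
    by (rule trans[OF map_pmf_cong[OF refl, of _ _ "\<lambda>x. x"]])
      (auto simp: map_pmf_ident block_concat3 dest!: length_block_law)
  moreover have "?P 0 2"
    unfolding block_law.simps map_pmf_comp
    by (rule trans[OF map_pmf_cong[OF refl] pair_add_block_law])
      (auto simp: block_concat3 dest!: length_block_law)
  moreover have "?P 1 2"
    unfolding block_law.simps map_pmf_comp
    by (rule trans[OF map_pmf_cong[OF refl] pair_add_block_law'])
      (auto simp: block_concat3 dest!: length_block_law)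
  moreover have "(s, t) \<in> {(0,1),(0,2),(1,2),(1,0),(2,0),(2,1)}"
    using assms by auto
  ultimately show ?thesis
    by (auto intro: swap_pair_pmf_eq)
qed

lemma third_law:
  assumes "s < 3"
  shows "map_pmf (block k s) (block_law (Suc k)) = block_law k"
proof -
  obtain t :: nat where t: "t < 3" "t \<noteq> s"
    by (metis one_less_numeral_iff semiring_norm(77) zero_less_numeral zero_neq_one)
  have "map_pmf (block k s) (block_law (Suc k)) =
      map_pmf fst (map_pmf (\<lambda>w. (block k s w, block k t w)) (block_law (Suc k)))"
    by (simp add: map_pmf_comp del: block_law.simps)
  also have "\<dots> = block_law k"
    using assms t by (simp add: thirds_law map_fst_pair_pmf del: block_law.simps)
  finally show ?thesis .
qed

lemma block_block:
  assumes "a < 3 ^ r"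
  shows "block k a (block (k + r) b w) = block k (b * 3 ^ r + a) w"
proof -
  have "a * 3 ^ k + 3 ^ k \<le> (3::nat) ^ (k + r)"
    using mult_le_mono1[of "Suc a" "3 ^ r" "3 ^ k"] assms by (simp add: power_add mult.commute)
  then show ?thesis
    by (simp add: block_def drop_take power_add algebra_simps)
qed

lemma block_law_block:
  "a < 3 ^ r \<Longrightarrow> map_pmf (block k a) (block_law (k + r)) = block_law k"
proof (induction r arbitrary: a)
  case 0
  then show ?case
    by (subst map_pmf_cong[OF refl, of _ _ "\<lambda>w. w"]) (auto simp: block_def map_pmf_ident length_block_law)
next
  case (Suc r)
  have d: "a mod 3 ^ r < 3 ^ r" "a div 3 ^ r < 3"
    using Suc.prems by (auto simp: less_mult_imp_div_less)
  \<comment> \<open>The leading base-3 digit of \<open>a\<close> selects a third, the remaining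
    digits the block inside it.\<close>
  have "map_pmf (block k a) (block_law (k + Suc r)) =
     map_pmf (block k (a mod 3 ^ r)) (map_pmf (block (k + r) (a div 3 ^ r)) (block_law (Suc (k + r))))"
    by (simp add: map_pmf_comp block_block d div_mult_mod_eq del: block_law.simps)
  also have "\<dots> = block_law k"
    unfolding third_law[OF d(2)] by (rule Suc.IH[OF d(1)])
  finally show ?case .
qed

text \<open>If the leading digits of \<open>a\<close> and \<open>b\<close> agree, both blocks lie in
  one third and the induction hypothesis applies there. If they differ, the two thirds are already
  independent and only the marginal law inside each is needed.\<close>

lemma block_law_pair_of_blocks:
  "a < 3 ^ r \<Longrightarrow> b < 3 ^ r \<Longrightarrow> a \<noteq> b \<Longrightarrow>
    map_pmf (\<lambda>w. (block k a w, block k b w)) (block_law (k + r)) = pair_pmf (block_law k) (block_law k)"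
proof (induction r arbitrary: a b)
  case 0
  then show ?case by simp
next
  case (Suc r)
  have d: "a mod 3 ^ r < 3 ^ r" "a div 3 ^ r < 3" "b mod 3 ^ r < 3 ^ r" "b div 3 ^ r < 3"
    using Suc.prems by (auto simp: less_mult_imp_div_less)
  show ?case
  proof (cases "a div 3 ^ r = b div 3 ^ r")
    case True
    then have ne: "a mod 3 ^ r \<noteq> b mod 3 ^ r"
      using Suc.prems(3) by (metis mult_div_mod_eq)
    have "b div 3 ^ r * 3 ^ r + a mod 3 ^ r = a"
      by (metis True div_mult_mod_eq)
    then have "map_pmf (\<lambda>w. (block k a w, block k b w)) (block_law (k + Suc r)) =
      map_pmf (\<lambda>w. (block k (a mod 3 ^ r) w, block k (b mod 3 ^ r) w))
        (map_pmf (block (k + r) (a div 3 ^ r)) (block_law (Suc (k + r))))"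
      using True by (simp add: map_pmf_comp block_block d div_mult_mod_eq del: block_law.simps)
    also have "\<dots> = pair_pmf (block_law k) (block_law k)"
      unfolding third_law[OF d(2)] by (rule Suc.IH[OF d(1) d(3) ne])
    finally show ?thesis .
  next
    case False
    have "map_pmf (\<lambda>w. (block k a w, block k b w)) (block_law (k + Suc r)) =
      map_pmf (\<lambda>(u, v). (block k (a mod 3 ^ r) u, block k (b mod 3 ^ r) v))
        (map_pmf (\<lambda>w. (block (k + r) (a div 3 ^ r) w, block (k + r) (b div 3 ^ r) w))
          (block_law (Suc (k + r))))"
      by (simp add: map_pmf_comp block_block d div_mult_mod_eq del: block_law.simps)
    also have "\<dots> = pair_pmf (block_law k) (block_law k)"
      unfolding thirds_law[OF d(2) d(4) False] by (simp add: map_pair block_law_block d)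
    finally show ?thesis .
  qed
qed

section \<open>The skeleton and conditional laws of blocks\<close>

text \<open>A finite alphabet leaves finitely many words of each length, so that events on block
  words split into finite sums.\<close>

instance bit :: finite
proof
  have "(UNIV :: bit set) = {0, 1}"
    by (auto intro: bit_not_one_iff)
  then show "finite (UNIV :: bit set)"
    by (metis finite.emptyI finite.insertI)
qed

section \<open>Offsets and nested blocks\<close>

lemma length_segment: "length (segment X i j \<omega>) = nat (j - i + 1)"
  by (simp add: segment_def)

lemma nth_segment: "t < nat (j - i + 1) \<Longrightarrow> segment X i j \<omega> ! t = X (i + int t) \<omega>"
  by (simp add: segment_def)

lemma length_block_word: "length (block_word S X k \<omega>) = 3 ^ k"
  by (simp add: block_word_def length_segment nat_power_eq)

lemma nth_block_word:
  "t < 3 ^ k \<Longrightarrow> block_word S X k \<omega> ! t = X (int t - block_offset S k \<omega>) \<omega>"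
  by (simp add: block_word_def nth_segment nat_power_eq)

lemma block_offset_0: "block_offset S 0 \<omega> = 0"
  by (simp add: block_offset_def)

lemma block_offset_Suc: "block_offset S (Suc k) \<omega> = block_offset S k \<omega> + int (S k \<omega>) * 3 ^ k"
  by (simp add: block_offset_def)

lemma block_offset_bounds:
  assumes "\<And>j. S j \<omega> < 3"
  shows "0 \<le> block_offset S k \<omega>" "block_offset S k \<omega> < 3 ^ k"
proof (induction k)
  case (Suc k)
  { case 1 then show ?case using Suc by (simp add: block_offset_Suc) }
  { case 2
    have "int (S k \<omega>) * 3 ^ k \<le> 2 * 3 ^ k"
      using assms[of k] by (intro mult_right_mono) auto
    then show ?case using Suc unfolding block_offset_Suc power_Suc by linarith }
qed (auto simp: block_offset_0)

text \<open>The digits from \<open>k\<close> on add multiples of \<open>3 ^ k\<close>, so the offset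
  at one scale determines those at all smaller scales.\<close>

lemma block_offset_mod:
  assumes "\<And>j. S j \<omega> < 3" "k \<le> K"
  shows "block_offset S K \<omega> mod 3 ^ k = block_offset S k \<omega>"
  using assms(2)
proof (induction K rule: dec_induct)
  case base
  then show ?case using block_offset_bounds[of S \<omega>, OF assms(1)] by simp
next
  case (step n)
  then have "(3::int) ^ k dvd int (S n \<omega>) * 3 ^ n"
    by (simp add: le_imp_power_dvd)
  then show ?case
    using step by (metis block_offset_Suc mod_add_right_eq add.right_neutral dvd_imp_mod_0)
qed

text \<open>This is the nesting of the intervals \<open>I_k\<close>: a digit is at most
  \<open>2\<close>, so adding \<open>S n * 3 ^ n\<close> keeps a position below \<open>3 ^ n\<close>
  under \<open>3 ^ Suc n\<close>.\<close>

lemma window_mono: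
  assumes "\<And>j. S j \<omega> < 3" "k \<le> K"
    "0 \<le> block_offset S k \<omega> + i" "block_offset S k \<omega> + i < 3 ^ k"
  shows "0 \<le> block_offset S K \<omega> + i \<and> block_offset S K \<omega> + i < 3 ^ K"
  using assms(2)
proof (induction K rule: dec_induct)
  case (step n)
  have "int (S n \<omega>) * 3 ^ n \<le> 2 * 3 ^ n"
    using assms(1)[of n] by (intro mult_right_mono) auto
  then show ?case
    using step.IH unfolding block_offset_Suc power_Suc
    by (smt (verit) mult_nonneg_nonneg of_nat_0_le_iff zero_le_power)
qed (use assms in auto)

lemma sum_base_3_digits: "(\<Sum>j<k. (n div 3 ^ j mod 3) * 3 ^ j) = n mod 3 ^ k" for n :: nat
proof (induction k)
  case (Suc k)
  have "n mod 3 ^ Suc k = 3 ^ k * (n div 3 ^ k mod 3) + n mod 3 ^ k"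
    by (metis mod_mult2_eq mult.commute power_Suc)
  then show ?case
    using Suc by simp
qed simp

text \<open>The intersection of the \<open>Z k\<close> is contained in each of them, hence null.
  This serves both to exhaust the integers by blocks and to reject wrong grids.\<close>

lemma (in prob_space) AE_ex_not_in_of_prob_tendsto_0:
  fixes b :: "nat \<Rightarrow> real"
  assumes le: "\<And>k. prob (Z k) \<le> b k" and b: "b \<longlonglongrightarrow> 0" and Z: "\<And>k. Z k \<in> events"
  shows "AE \<omega> in M. \<exists>k. \<omega> \<notin> Z k"
proof -
  have "prob (\<Inter>k. Z k) \<le> b k" for k
    using finite_measure_mono[of "\<Inter>k. Z k" "Z k"] Z le[of k] by fastforce
  then have "prob (\<Inter>k. Z k) = 0"
    using LIMSEQ_le_const[OF b] by (meson measure_le_0_iff)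
  then have "AE \<omega> in M. \<omega> \<notin> (\<Inter>k. Z k)"
    using Z by (intro AE_not_in) (auto simp: null_sets_def emeasure_eq_measure)
  then show ?thesis
    by eventually_elim blast
qed

context skeleton_process
begin

abbreviation "F \<equiv> skeleton_algebra M S"
abbreviation "N \<equiv> block_offset S"

section \<open>Measurability of the skeleton and of block words\<close>

lemma S_measurable [measurable]: "S k \<in> measurable M (count_space UNIV)"
  using S_indep unfolding indep_vars_def by auto

declare X_measurable [measurable]

lemma S_in_F [measurable]: "S k \<in> measurable F (count_space UNIV)"
proof -
  have "(\<lambda>\<omega> k. S k \<omega>) \<in> measurable F (Pi\<^sub>M UNIV (\<lambda>_. count_space UNIV))"
    unfolding skeleton_algebra_def by (rule measurable_vimage_algebra1) (auto simp: space_PiM)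
  then show ?thesis
    by (rule measurable_compose[of _ _ _ "\<lambda>s. s k"]) simp
qed

lemma space_F: "space F = space M"
  by (simp add: skeleton_algebra_def)

lemma subalgebra_F: "subalgebra M F"
proof -
  have "(\<lambda>\<omega> k. S k \<omega>) \<in> measurable M (Pi\<^sub>M UNIV (\<lambda>_. count_space UNIV))"
    by (rule measurable_PiM_single') auto
  then have "sets F \<subseteq> sets M"
    unfolding skeleton_algebra_def by (subst sets_vimage_algebra2) (auto simp: space_PiM)
  then show ?thesis
    by (simp add: subalgebra_def space_F)
qed

sublocale F: finite_measure_subalgebra M F
  using subalgebra_F by unfold_locales

lemma F_sets_M: "A \<in> sets F \<Longrightarrow> A \<in> sets M"
  using subalgebra_F by (auto simp: subalgebra_def)

lemma N_in_F [measurable]: "N k \<in> measurable F (count_space UNIV)"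
proof (induction k)
  case (Suc k)
  have "(\<lambda>\<omega>. a + int (S k \<omega>) * 3 ^ k) \<in> measurable F (count_space UNIV)" for a
    by (rule measurable_compose[OF S_in_F]) simp
  then have "(\<lambda>\<omega>. N k \<omega> + int (S k \<omega>) * 3 ^ k) \<in> measurable F (count_space UNIV)"
    using measurable_compose_countable[OF _ Suc, of "\<lambda>a \<omega>. a + int (S k \<omega>) * 3 ^ k"] by simp
  then show ?case
    by (simp add: block_offset_Suc[abs_def])
qed (simp add: block_offset_0[abs_def])

lemma N_measurable [measurable]: "N k \<in> measurable M (count_space UNIV)"
  using subalgebra_F N_in_F by (rule measurable_from_subalg)

lemma N_event: "{\<omega> \<in> space M. N k \<omega> \<in> B} \<in> sets M"
  by measurable

lemma map_X_measurable [measurable]: "(\<lambda>\<omega>. map (\<lambda>n. X n \<omega>) ns) \<in> measurable M (count_space UNIV)"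
proof (induction ns)
  case (Cons n ns)
  have "(\<lambda>\<omega>. b # map (\<lambda>n. X n \<omega>) ns) \<in> measurable M (count_space UNIV)" for b
    by (rule measurable_compose[OF Cons]) simp
  then show ?case
    using measurable_compose_countable[OF _ X_measurable, of "\<lambda>b \<omega>. b # map (\<lambda>n. X n \<omega>) ns"]
    by simp
qed simp

lemma segment_measurable [measurable]: "segment X i j \<in> measurable M (count_space UNIV)"
  by (simp add: segment_def[abs_def])

lemma block_word_measurable [measurable]: "block_word S X k \<in> measurable M (count_space UNIV)"
  unfolding block_word_def[abs_def]
  by (rule measurable_compose_countable[OF segment_measurable N_measurable])

section \<open>Uniform law of the offset\<close>

lemma prob_S:
  assumes "d < 3"
  shows "prob {\<omega> \<in> space M. S k \<omega> = d} = 1 / 3"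
proof -
  have "prob (S k -` {d} \<inter> space M) = measure (distr M (count_space UNIV) (S k)) {d}"
    by (subst measure_distr) auto
  also have "\<dots> = 1 / 3"
  proof -
    have "{0, 1, 2} \<inter> {d} = {d}"
      using assms by auto
    then show ?thesis
      unfolding S_uniform by (subst measure_pmf_of_set) auto
  qed
  finally show ?thesis
    by (simp add: vimage_def Int_def conj_commute)
qed

lemma AE_S: "AE \<omega> in M. \<forall>k. S k \<omega> < 3"
proof -
  have "AE \<omega> in M. S k \<omega> < 3" for k
  proof -
    have "AE s in distr M (count_space UNIV) (S k). s < 3"
      unfolding S_uniform by (subst AE_measure_pmf_iff) auto
    then show ?thesis
      by (subst (asm) AE_distr_iff) auto
  qed
  then show ?thesis
    by (simp add: AE_all_countable)
qed

text \<open>Prescribing the first \<open>K\<close> skeleton digits to be the base-3 digits of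
  \<open>n\<close> forces the offset, and by independence these digits have probability
  \<open>1 / 3 ^ K\<close>.\<close>

lemma prob_offset_ge:
  assumes "n < 3 ^ K"
  shows "1 / 3 ^ K \<le> prob {\<omega> \<in> space M. N K \<omega> = int n}"
\<comment> \<open>Scale \<open>0\<close> is separate because the product rule for independent
  variables asks for a nonempty index set.\<close>
proof (cases "K = 0")
  case True
  then show ?thesis
    using assms by (simp add: block_offset_0 prob_space)
next
  case False
  let ?d = "\<lambda>j. n div 3 ^ j mod 3"
  have "prob (\<Inter>j\<in>{..<K}. S j -` {?d j} \<inter> space M) = (\<Prod>j<K. prob (S j -` {?d j} \<inter> space M))"
    using False by (intro indep_varsD[OF S_indep]) auto
  also have "\<dots> = (\<Prod>j<K. 1 / 3)"
    by (intro prod.cong refl prob_S[unfolded Collect_conj_eq[of "\<lambda>x. x \<in> space M"], THEN trans[rotated]])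
      (auto intro!: arg_cong[where f = prob])
  also have "\<dots> = 1 / 3 ^ K"
    by (simp add: power_one_over)
  finally have "1 / 3 ^ K = prob (\<Inter>j\<in>{..<K}. S j -` {?d j} \<inter> space M)" ..
  also have "\<dots> \<le> prob {\<omega> \<in> space M. N K \<omega> = int n}"
  proof (rule finite_measure_mono)
    show "(\<Inter>j\<in>{..<K}. S j -` {?d j} \<inter> space M) \<subseteq> {\<omega> \<in> space M. N K \<omega> = int n}"
    proof safe
      fix \<omega> assume *: "\<omega> \<in> (\<Inter>j\<in>{..<K}. S j -` {?d j} \<inter> space M)"
      then have d: "\<omega> \<in> space M \<and> (\<forall>j<K. S j \<omega> = ?d j)"
        using False by (auto simp: lessThan_empty_iff split: if_splits)
      then show "\<omega> \<in> space M" ..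
      have "N K \<omega> = (\<Sum>j<K. int (?d j) * 3 ^ j)"
        unfolding block_offset_def using d by (intro sum.cong) auto
      also have "\<dots> = int (\<Sum>j<K. ?d j * 3 ^ j)"
        by simp
      also have "\<dots> = int n"
        using assms by (subst sum_base_3_digits) simp
      finally show "N K \<omega> = int n" .
    qed
  qed measurable
  finally show ?thesis .
qed

lemma prob_offset_sum:
  assumes "finite B"
  shows "prob {\<omega> \<in> space M. N K \<omega> \<in> B} = (\<Sum>n\<in>B. prob {\<omega> \<in> space M. N K \<omega> = n})"
proof -
  have "prob (\<Union>n\<in>B. {\<omega> \<in> space M. N K \<omega> = n}) = (\<Sum>n\<in>B. prob {\<omega> \<in> space M. N K \<omega> = n})"
    using assms by (intro finite_measure_finite_Union) (auto simp: disjoint_family_on_def)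
  then show ?thesis
    by (smt (verit) Collect_cong UN_iff mem_Collect_eq Collect_mem_eq)
qed

text \<open>The \<open>3 ^ K\<close> disjoint events each have probability at least
  \<open>1 / 3 ^ K\<close> and together at most \<open>1\<close>, so none can exceed its
  share.\<close>

lemma prob_offset:
  assumes "0 \<le> n" "n < 3 ^ K"
  shows "prob {\<omega> \<in> space M. N K \<omega> = n} = 1 / 3 ^ K"
proof (rule antisym)
  have ge: "1 / 3 ^ K \<le> prob {\<omega> \<in> space M. N K \<omega> = m}" if "m \<in> {0..<3 ^ K}" for m
  proof -
    have "nat m < 3 ^ K"
      using that by (auto simp: nat_less_iff)
    then show ?thesis
      using prob_offset_ge[of "nat m" K] that by simp
  qed
  then show "1 / 3 ^ K \<le> prob {\<omega> \<in> space M. N K \<omega> = n}"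
    using assms by simp
  have n: "n \<in> {0..<3 ^ K}" using assms by simp
  have "(\<Sum>m\<in>{0..<3 ^ K} - {n}. 1 / 3 ^ K) \<le> (\<Sum>m\<in>{0..<3 ^ K} - {n}. prob {\<omega> \<in> space M. N K \<omega> = m})"
    by (intro sum_mono ge) auto
  moreover have "(\<Sum>m\<in>{0..<3 ^ K}. prob {\<omega> \<in> space M. N K \<omega> = m}) \<le> 1"
    by (subst prob_offset_sum[symmetric]) auto
  moreover have "(\<Sum>m\<in>{0..<3 ^ K :: int}. 1 / 3 ^ K :: real) = 1"
    by simp
  ultimately show "prob {\<omega> \<in> space M. N K \<omega> = n} \<le> 1 / 3 ^ K"
    using sum.remove[OF _ n, of "\<lambda>m. 1 / 3 ^ K :: real"]
      sum.remove[OF _ n, of "\<lambda>m. prob {\<omega> \<in> space M. N K \<omega> = m}"] by simp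
qed

lemma prob_offset_in:
  "prob {\<omega> \<in> space M. N K \<omega> \<in> B} = card (B \<inter> {0..<3 ^ K}) / 3 ^ K"
proof -
  have "prob {\<omega> \<in> space M. N K \<omega> \<in> B} = prob {\<omega> \<in> space M. N K \<omega> \<in> B \<inter> {0..<3 ^ K}}"
    using AE_S by (intro finite_measure_eq_AE) (auto simp: block_offset_bounds elim!: eventually_mono)
  also have "\<dots> = (\<Sum>n\<in>B \<inter> {0..<3 ^ K}. prob {\<omega> \<in> space M. N K \<omega> = n})"
    by (rule prob_offset_sum) simp
  also have "\<dots> = card (B \<inter> {0..<3 ^ K}) / 3 ^ K"
    by (simp add: prob_offset)
  finally show ?thesis .
qed

text \<open>At most \<open>\<bar>i\<bar>\<close> of the \<open>3 ^ k\<close> equally likely offsets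
  leave \<open>i\<close> outside the block, so almost surely some block contains \<open>i\<close>;
  nesting then gives all larger ones.\<close>

lemma AE_window: "AE \<omega> in M. \<forall>i. \<exists>k. \<forall>K\<ge>k. 0 \<le> N K \<omega> + i \<and> N K \<omega> + i < 3 ^ K"
proof -
  have "AE \<omega> in M. \<exists>k. 0 \<le> N k \<omega> + i \<and> N k \<omega> + i < 3 ^ k" for i
  proof -
    define B where "B k = {n :: int. \<not> (0 \<le> n + i \<and> n + i < 3 ^ k)}" for k :: nat
    have "prob {\<omega> \<in> space M. N k \<omega> \<in> B k} \<le> real_of_int \<bar>i\<bar> / 3 ^ k" for k
    proof -
      have "card (B k \<inter> {0..<3 ^ k}) \<le> card ({0..<- i} \<union> {3 ^ k - i..<3 ^ k})"
        by (intro card_mono) (auto simp: B_def)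
      also have "\<dots> \<le> card {0..<- i} + card {3 ^ k - i..<3 ^ k}"
        by (rule card_Un_le)
      also have "\<dots> = nat \<bar>i\<bar>"
        by simp
      finally show ?thesis
        unfolding prob_offset_in by (intro divide_right_mono) auto
    qed
    moreover have "(\<lambda>k. real_of_int \<bar>i\<bar> / 3 ^ k) \<longlonglongrightarrow> 0"
      by real_asymp
    ultimately have "AE \<omega> in M. \<exists>k. \<omega> \<notin> {\<omega> \<in> space M. N k \<omega> \<in> B k}"
      by (intro AE_ex_not_in_of_prob_tendsto_0 N_event)
    with AE_space show ?thesis
      by eventually_elim (auto simp: B_def)
  qed
  then have "AE \<omega> in M. \<forall>i. \<exists>k. 0 \<le> N k \<omega> + i \<and> N k \<omega> + i < 3 ^ k"
    by (simp add: AE_all_countable)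
  with AE_S show ?thesis
  proof eventually_elim
    case (elim \<omega>)
    show ?case
    proof
      fix i
      obtain k where "0 \<le> N k \<omega> + i" "N k \<omega> + i < 3 ^ k"
        using elim by blast
      then show "\<exists>k. \<forall>K\<ge>k. 0 \<le> N K \<omega> + i \<and> N K \<omega> + i < 3 ^ K"
        using elim(1) window_mono[of S \<omega> k] by blast
    qed
  qed
qed

section \<open>Conditional laws given the skeleton\<close>

lemma prob_given_block_word_in:
  "AE \<omega> in M. prob_given M F {\<omega> \<in> space M. block_word S X K \<omega> \<in> W} \<omega> = measure (block_law K) W"
proof -
  \<comment> \<open>Only words of the right length can occur. Cutting \<open>W\<close> down to them
    gives a finite set, over which the assumption on single words is summed.\<close>
  define V where "V = W \<inter> {w. length w = 3 ^ K}"
  let ?A = "\<lambda>w. {\<omega> \<in> space M. block_word S X K \<omega> = w}"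
  have fin: "finite V"
    unfolding V_def using finite_lists_length_eq[OF finite, of UNIV "3 ^ K"]
    by (intro finite_Int) auto
  have ind: "indicator {\<omega> \<in> space M. block_word S X K \<omega> \<in> W} = (\<lambda>\<omega>. \<Sum>w\<in>V. indicator (?A w) \<omega> :: real)"
  proof
    fix \<omega>
    have "(\<Sum>w\<in>V. indicator (?A w) \<omega> :: real) = (\<Sum>w\<in>V. if w = block_word S X K \<omega> then of_bool (\<omega> \<in> space M) else 0)"
      by (intro sum.cong) (auto simp: indicator_def)
    also have "\<dots> = indicator {\<omega> \<in> space M. block_word S X K \<omega> \<in> W} \<omega>"
      using fin by (auto simp: indicator_def V_def length_block_word)
    finally show "indicator {\<omega> \<in> space M. block_word S X K \<omega> \<in> W} \<omega> = (\<Sum>w\<in>V. indicator (?A w) \<omega> :: real)" ..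
  qed
  have "AE \<omega> in M. real_cond_exp M F (\<lambda>\<omega>. \<Sum>w\<in>V. indicator (?A w) \<omega>) \<omega> = (\<Sum>w\<in>V. real_cond_exp M F (indicator (?A w)) \<omega>)"
    by (rule F.real_cond_exp_sum) (auto intro!: integrable_real_indicator simp: emeasure_eq_measure)
  moreover have "AE \<omega> in M. \<forall>w\<in>V. real_cond_exp M F (indicator (?A w)) \<omega> = pmf (block_law K) w"
    using block_cond_law fin unfolding prob_given_def by (intro AE_finite_allI) auto
  moreover have "measure (block_law K) W = (\<Sum>w\<in>V. pmf (block_law K) w)"
  proof -
    have "measure (block_law K) W = measure (block_law K) V"
      by (intro measure_pmf.finite_measure_eq_AE)
        (auto simp: AE_measure_pmf_iff V_def length_block_law)
    then show ?thesis
      using fin by (simp add: measure_measure_pmf_finite)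
  qed
  ultimately show ?thesis
    unfolding prob_given_def ind by (auto elim!: eventually_elim2)
qed

text \<open>The word read inside the block may depend on the skeleton through the position of \<open>0\<close> in the block,
  which is what makes this applicable to windows fixed in \<open>\<int>\<close>.\<close>

lemma prob_given_eq_block_law:
  assumes C [measurable]: "C \<in> sets M"
    and W: "\<And>\<omega>. \<omega> \<in> space M \<Longrightarrow> P (N K \<omega>) \<Longrightarrow> \<omega> \<in> C \<longleftrightarrow> block_word S X K \<omega> \<in> W (N K \<omega>)"
  shows "AE \<omega> in M. P (N K \<omega>) \<longrightarrow> prob_given M F C \<omega> = measure (block_law K) (W (N K \<omega>))"
proof -
  have "AE \<omega> in M. N K \<omega> = n \<longrightarrow> prob_given M F C \<omega> = measure (block_law K) (W n)" if "P n" for n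
  proof -
    let ?A = "{\<omega> \<in> space F. N K \<omega> = n}"
    let ?D = "{\<omega> \<in> space M. block_word S X K \<omega> \<in> W n}"
    have A [measurable]: "?A \<in> sets F"
      by measurable
    note [measurable] = F_sets_M[OF A]
    have *: "AE \<omega> in M. real_cond_exp M F (\<lambda>\<omega>. indicator ?A \<omega> * indicator E \<omega>) \<omega>
        = indicator ?A \<omega> * real_cond_exp M F (indicator E) \<omega>" if [measurable]: "E \<in> sets M" for E
      by (rule F.real_cond_exp_mult)
        (auto intro!: integrable_real_indicator simp: emeasure_eq_measure indicator_inter_arith[symmetric])
    \<comment> \<open>On \<open>?A\<close> the event \<open>C\<close> coincides with
      \<open>?D\<close>, whose conditional probability is constant; as \<open>?A\<close> lies in
      \<open>F\<close>, its indicator can be pulled out on both sides.\<close>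
    have "(\<lambda>\<omega>. indicator ?A \<omega> * indicator C \<omega> :: real) = (\<lambda>\<omega>. indicator ?A \<omega> * indicator ?D \<omega>)"
      using W that by (auto simp: indicator_def space_F fun_eq_iff)
    then show ?thesis
      using *[OF C] *[of ?D] prob_given_block_word_in[of K "W n"] AE_space
      unfolding prob_given_def by (auto simp: indicator_def space_F elim!: eventually_elim2)
  qed
  then have "AE \<omega> in M. \<forall>n. P n \<longrightarrow> N K \<omega> = n \<longrightarrow> prob_given M F C \<omega> = measure (block_law K) (W n)"
    unfolding AE_all_countable by (auto simp: AE_conj_iff)
  then show ?thesis
    by eventually_elim auto
qed

lemma prob_block_word_in:
  "prob {\<omega> \<in> space M. block_word S X K \<omega> \<in> W} = measure (block_law K) W" (is "prob ?D = _")
proof -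
  have "prob ?D = (\<integral>\<omega>. indicator ?D \<omega> \<partial>M)"
    by simp
  also have "\<dots> = (\<integral>\<omega>. prob_given M F ?D \<omega> \<partial>M)"
    unfolding prob_given_def
    by (rule F.real_cond_exp_int(2)[symmetric]) (auto intro!: integrable_real_indicator simp: emeasure_eq_measure)
  also have "\<dots> = (\<integral>\<omega>. measure (block_law K) W \<partial>M)"
    by (intro integral_cong_AE prob_given_block_word_in) (auto simp: prob_given_def)
  finally show ?thesis
    by (simp add: prob_space)
qed

text \<open>The event \<open>N K = n\<close> lies in \<open>F\<close>, so the constant value that
  the conditional probability takes there can be integrated over it.\<close>

lemma prob_offset_inter:
  assumes C [measurable]: "C \<in> sets M"
    and W: "\<And>\<omega>. \<omega> \<in> space M \<Longrightarrow> N K \<omega> = n \<Longrightarrow> \<omega> \<in> C \<longleftrightarrow> block_word S X K \<omega> \<in> W"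
  shows "prob (C \<inter> {\<omega> \<in> space M. N K \<omega> = n}) = prob {\<omega> \<in> space M. N K \<omega> = n} * measure (block_law K) W"
proof -
  let ?A = "{\<omega> \<in> space M. N K \<omega> = n}"
  have A: "?A \<in> sets F"
    using measurable_sets[OF N_in_F, of "{n}" K] by (auto simp: space_F vimage_def Int_def conj_commute)
  note [measurable] = F_sets_M[OF A]
  have "prob (C \<inter> ?A) = (\<integral>\<omega>\<in>?A. indicator C \<omega> \<partial>M)"
    by (simp add: set_lebesgue_integral_def indicator_inter_arith[symmetric] Int_commute)
  also have "\<dots> = (\<integral>\<omega>\<in>?A. prob_given M F C \<omega> \<partial>M)"
    unfolding prob_given_def
    by (rule F.real_cond_exp_intA) (auto intro!: integrable_real_indicator simp: emeasure_eq_measure A)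
  also have "\<dots> = (\<integral>\<omega>\<in>?A. measure (block_law K) W \<partial>M)"
    unfolding set_lebesgue_integral_def
    using prob_given_eq_block_law[OF C, of "\<lambda>m. m = n" K "\<lambda>_. W"] W
    by (intro integral_cong_AE) (auto simp: prob_given_def indicator_def elim!: eventually_mono)
  also have "\<dots> = prob ?A * measure (block_law K) W"
    by (simp add: set_lebesgue_integral_def)
  finally show ?thesis .
qed

lemma AE_block_word_support: "AE \<omega> in M. \<forall>K. block_word S X K \<omega> \<in> set_pmf (block_law K)"
proof -
  have "AE \<omega> in M. block_word S X K \<omega> \<in> set_pmf (block_law K)" for K
  proof -
    have "prob {\<omega> \<in> space M. block_word S X K \<omega> \<in> set_pmf (block_law K)} = 1"
      unfolding prob_block_word_in by (rule measure_pmf.prob_eq_1[THEN iffD2]) (auto simp: AE_measure_pmf)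
    then have "AE \<omega> in M. \<omega> \<in> {\<omega> \<in> space M. block_word S X K \<omega> \<in> set_pmf (block_law K)}"
      by (subst prob_eq_1[symmetric]) auto
    then show ?thesis
      by eventually_elim auto
  qed
  then show ?thesis
    by (simp add: AE_all_countable)
qed

end

section \<open>Stationarity and mixing\<close>

text \<open>Coordinate \<open>i\<close> of the process is letter
  \<open>block_offset S K \<omega> + i\<close> of the block word. Hence a fixed window depends on
  the skeleton only through the place where it is read in that word.\<close>

lemma segment_eq_block_word:
  assumes "0 \<le> block_offset S K \<omega> + i" "block_offset S K \<omega> + j < 3 ^ K"
  shows "segment X i j \<omega> =
    take (nat (j - i + 1)) (drop (nat (block_offset S K \<omega> + i)) (block_word S X K \<omega>))"
proof (rule nth_equalityI)
  have "nat (j - i + 1) \<le> 3 ^ K - nat (block_offset S K \<omega> + i)"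
    using assms by (cases "i \<le> j") (auto simp: le_diff_conv2 nat_le_iff nat_power_eq of_nat_diff)
  then show "length (segment X i j \<omega>) =
      length (take (nat (j - i + 1)) (drop (nat (block_offset S K \<omega> + i)) (block_word S X K \<omega>)))"
    by (simp add: length_segment length_block_word)
  fix t assume "t < length (segment X i j \<omega>)"
  then have t: "t < nat (j - i + 1)"
    by (simp add: length_segment)
  then have "int (nat (block_offset S K \<omega> + i) + t) < 3 ^ K"
    using assms by simp
  then have "nat (block_offset S K \<omega> + i) + t < 3 ^ K"
    by (metis of_nat_less_numeral_power_cancel_iff)
  then show "segment X i j \<omega> ! t =
      take (nat (j - i + 1)) (drop (nat (block_offset S K \<omega> + i)) (block_word S X K \<omega>)) ! t"
    using t assms by (simp add: nth_segment nth_block_word length_block_word)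
qed

lemma take_drop_block:
  assumes "a mod 3 ^ k + l < 3 ^ k"
  shows "take (l + 1) (drop (a mod 3 ^ k) (block k (a div 3 ^ k) w)) = take (l + 1) (drop a w)"
proof -
  have "a mod 3 ^ k + a div 3 ^ k * 3 ^ k = a"
    by (rule mod_div_mult_eq)
  then show ?thesis
    using assms by (simp add: block_def drop_take min_def)
qed

text \<open>The two conditions modulo \<open>3 ^ k\<close> place each window inside a single
  \<open>k\<close>-block, and a gap of at least \<open>3 ^ k\<close> makes these blocks distinct,
  hence independent.\<close>

lemma block_law_subwords_indep:
  assumes "a + 3 ^ k \<le> b" "b < 3 ^ K" "k \<le> K" "a mod 3 ^ k + l < 3 ^ k" "b mod 3 ^ k + l < 3 ^ k"
  shows "measure (block_law K) {w. take (l + 1) (drop a w) \<in> E1 \<and> take (l + 1) (drop b w) \<in> E2} =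
    measure (block_law K) {w. take (l + 1) (drop a w) \<in> E1} *
    measure (block_law K) {w. take (l + 1) (drop b w) \<in> E2}"
proof -
  obtain r where K: "K = k + r"
    using assms(3) le_Suc_ex by blast
  let ?V1 = "{v. take (l + 1) (drop (a mod 3 ^ k) v) \<in> E1}"
  let ?V2 = "{v. take (l + 1) (drop (b mod 3 ^ k) v) \<in> E2}"
  have lt: "b div 3 ^ k < 3 ^ r" "a div 3 ^ k < 3 ^ r"
    using assms by (auto simp: K power_add mult.commute intro!: less_mult_imp_div_less)
  have "a div 3 ^ k + 1 \<le> b div 3 ^ k"
    using div_le_mono[OF assms(1), of "3 ^ k"] by simp
  then have ne: "a div 3 ^ k \<noteq> b div 3 ^ k"
    by simp
  have "measure (block_law K) {w. take (l + 1) (drop a w) \<in> E1 \<and> take (l + 1) (drop b w) \<in> E2} =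
    measure (map_pmf (\<lambda>w. (block k (a div 3 ^ k) w, block k (b div 3 ^ k) w)) (block_law K)) (?V1 \<times> ?V2)"
    unfolding measure_map_pmf
    by (rule arg_cong[where f = "measure _"]) (auto simp: take_drop_block assms simp del: One_nat_def add_Suc_right add_0_right)
  also have "\<dots> = measure (block_law k) ?V1 * measure (block_law k) ?V2"
    unfolding K block_law_pair_of_blocks[OF lt(2,1) ne] by (rule measure_pmf_prob_product) auto
  also have "measure (block_law k) ?V1 = measure (map_pmf (block k (a div 3 ^ k)) (block_law K)) ?V1"
    unfolding K block_law_block[OF lt(2)] ..
  also have "\<dots> = measure (block_law K) {w. take (l + 1) (drop a w) \<in> E1}"
    unfolding measure_map_pmf
    by (rule arg_cong[where f = "measure _"]) (auto simp: take_drop_block assms simp del: One_nat_def add_Suc_right add_0_right)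
  also have "measure (block_law k) ?V2 = measure (map_pmf (block k (b div 3 ^ k)) (block_law K)) ?V2"
    unfolding K block_law_block[OF lt(1)] ..
  also have "\<dots> = measure (block_law K) {w. take (l + 1) (drop b w) \<in> E2}"
    unfolding measure_map_pmf
    by (rule arg_cong[where f = "measure _"]) (auto simp: take_drop_block assms simp del: One_nat_def add_Suc_right add_0_right)
  finally show ?thesis .
qed

text \<open>A single letter is a block of order \<open>0\<close>, so its law is the marginal law
  \<open>block_law 0\<close>.\<close>

lemma block_law_coordinate:
  assumes "a < 3 ^ K"
  shows "measure (block_law K) {w. take 1 (drop a w) \<in> {[b]}} = 1 / 2"
proof -
  have b: "b \<in> {0, 1}"
    by (cases b) auto
  have "measure (block_law K) {w. take 1 (drop a w) \<in> {[b]}} = measure (map_pmf (block 0 a) (block_law (0 + K))) {[b]}"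
    unfolding measure_map_pmf by (auto simp: block_def vimage_def)
  also have "\<dots> = measure (block_law 0) {[b]}"
    using assms by (subst block_law_block) auto
  also have "\<dots> = measure (pmf_of_set {0, 1}) {b}"
    by (simp add: vimage_def)
  also have "\<dots> = 1 / 2"
  proof -
    have "{0, 1} \<inter> {b} = {b}"
      using b by auto
    then show ?thesis
      by (subst measure_pmf_of_set) auto
  qed
  finally show ?thesis .
qed

lemma block_law_thirds_sum_0:
  assumes w: "w \<in> set_pmf (block_law (Suc k))" and t: "t < 3 ^ k"
  shows "w ! t + w ! (t + 3 ^ k) + w ! (t + 2 * 3 ^ k) = 0"
proof -
  obtain U V where "length U = 3 ^ k" "length V = 3 ^ k" "w = U @ V @ map2 (+) U V"
    using w by (auto dest!: length_block_law)
  then show ?thesis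
    using t by (simp add: nth_append add.assoc)
qed

context skeleton_process
begin

section \<open>Stationarity\<close>

lemma prob_Int_offset_in:
  assumes "finite B" "C \<in> sets M"
  shows "prob (C \<inter> {\<omega> \<in> space M. N K \<omega> \<in> B}) = (\<Sum>n\<in>B. prob (C \<inter> {\<omega> \<in> space M. N K \<omega> = n}))"
proof -
  have "prob (\<Union>n\<in>B. C \<inter> {\<omega> \<in> space M. N K \<omega> = n}) = (\<Sum>n\<in>B. prob (C \<inter> {\<omega> \<in> space M. N K \<omega> = n}))"
    using assms N_event[of K "{_}"]
    by (intro finite_measure_finite_Union) (auto simp: disjoint_family_on_def)
  also have "(\<Union>n\<in>B. C \<inter> {\<omega> \<in> space M. N K \<omega> = n}) = C \<inter> {\<omega> \<in> space M. N K \<omega> \<in> B}"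
    by auto
  finally show ?thesis .
qed

lemma segment_event_sets: "{\<omega> \<in> space M. segment X i j \<omega> \<in> E} \<in> sets M"
  by measurable

text \<open>Replacing the offset \<open>n\<close> by \<open>n - 1\<close> moves the window one step to the right inside the same block
  word, and both offsets are equally likely.\<close>

lemma prob_segment_shift_le_add:
  "prob {\<omega> \<in> space M. segment X i j \<omega> \<in> E}
    \<le> prob {\<omega> \<in> space M. segment X (i + 1) (j + 1) \<omega> \<in> E} + (1 + \<bar>i\<bar> + \<bar>j\<bar>) / 3 ^ K"
proof -
  \<comment> \<open>The bound \<open>1 \<le> n\<close> keeps \<open>n - 1\<close> a possible offset;
    the last two bounds keep the window inside the block.\<close>
  define H :: "int set" where "H = {n. 1 \<le> n \<and> n < 3 ^ K \<and> 0 \<le> n + i \<and> n + j < 3 ^ K}"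
  define C where "C = {\<omega> \<in> space M. segment X i j \<omega> \<in> E}"
  define C' where "C' = {\<omega> \<in> space M. segment X (i + 1) (j + 1) \<omega> \<in> E}"
  let ?W = "\<lambda>n. {w. take (nat (j - i + 1)) (drop (nat (n + i)) w) \<in> E}"
  have H: "finite H"
    unfolding H_def by (rule finite_subset[of _ "{1..<3 ^ K}"]) auto
  have C: "C \<in> events" "C' \<in> events"
    unfolding C_def C'_def by (rule segment_event_sets)+
  have eq: "prob (C \<inter> {\<omega> \<in> space M. N K \<omega> = n}) = prob (C' \<inter> {\<omega> \<in> space M. N K \<omega> = n - 1})" if "n \<in> H" for n
  proof -
    have "prob (C \<inter> {\<omega> \<in> space M. N K \<omega> = n}) = prob {\<omega> \<in> space M. N K \<omega> = n} * measure (block_law K) (?W n)"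
      using that by (intro prob_offset_inter C) (auto simp: C_def H_def segment_eq_block_word[of S K])
    moreover have "prob (C' \<inter> {\<omega> \<in> space M. N K \<omega> = n - 1}) = prob {\<omega> \<in> space M. N K \<omega> = n - 1} * measure (block_law K) (?W n)"
      using that by (intro prob_offset_inter C) (auto simp: C'_def H_def segment_eq_block_word[of S K])
    ultimately show ?thesis
      using that by (simp add: prob_offset H_def)
  qed
  have "prob C \<le> prob (C \<inter> {\<omega> \<in> space M. N K \<omega> \<in> H} \<union> {\<omega> \<in> space M. N K \<omega> \<in> - H})"
    using C N_event by (intro finite_measure_mono sets.Un sets.Int) (auto simp: C_def)
  also have "\<dots> \<le> prob (C \<inter> {\<omega> \<in> space M. N K \<omega> \<in> H}) + prob {\<omega> \<in> space M. N K \<omega> \<in> - H}"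
    using C N_event by (intro measure_Un_le sets.Int)
  also have "prob (C \<inter> {\<omega> \<in> space M. N K \<omega> \<in> H}) = (\<Sum>n\<in>H. prob (C' \<inter> {\<omega> \<in> space M. N K \<omega> = n - 1}))"
    using H C eq by (simp add: prob_Int_offset_in)
  also have "\<dots> = prob (C' \<inter> {\<omega> \<in> space M. N K \<omega> \<in> (\<lambda>n. n - 1) ` H})"
    using H C by (subst prob_Int_offset_in) (auto simp: sum.reindex inj_on_def)
  also have "\<dots> \<le> prob C'"
    using C by (intro finite_measure_mono) auto
  also have "prob {\<omega> \<in> space M. N K \<omega> \<in> - H} \<le> (1 + \<bar>i\<bar> + \<bar>j\<bar>) / 3 ^ K"
  proof -
    \<comment> \<open>The excluded offsets are \<open>0\<close>, those below \<open>- i\<close> and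
      those from \<open>3 ^ K - j\<close> on.\<close>
    have "card (- H \<inter> {0..<3 ^ K}) \<le> card (({0} \<union> {0..<- i}) \<union> {3 ^ K - j..<3 ^ K})"
      by (intro card_mono) (auto simp: H_def)
    also have "\<dots> \<le> card ({0} \<union> {0..<- i}) + card {3 ^ K - j..<3 ^ K}"
      by (rule card_Un_le)
    also have "card ({0} \<union> {0..<- i}) \<le> card {0::int} + card {0..<- i}"
      by (rule card_Un_le)
    finally have "card (- H \<inter> {0..<3 ^ K}) \<le> 1 + nat \<bar>i\<bar> + nat \<bar>j\<bar>"
      by simp
    then have "real (card (- H \<inter> {0..<3 ^ K})) \<le> real (1 + nat \<bar>i\<bar> + nat \<bar>j\<bar>)"
      by (rule of_nat_mono)
    then show ?thesis
      unfolding prob_offset_in by (intro divide_right_mono) auto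
  qed
  finally show ?thesis
    unfolding C_def C'_def by simp
qed

text \<open>The error at scale \<open>K\<close> vanishes as \<open>K\<close> grows, which gives one
  inequality for every \<open>E\<close>; applied to \<open>- E\<close> it gives the other.\<close>

lemma prob_segment_shift:
  "prob {\<omega> \<in> space M. segment X (i + 1) (j + 1) \<omega> \<in> E} = prob {\<omega> \<in> space M. segment X i j \<omega> \<in> E}"
proof -
  have le: "prob {\<omega> \<in> space M. segment X i j \<omega> \<in> E} \<le> prob {\<omega> \<in> space M. segment X (i + 1) (j + 1) \<omega> \<in> E}" for E
  proof -
    let ?c = "1 + real_of_int \<bar>i\<bar> + real_of_int \<bar>j\<bar>"
    have lim: "(\<lambda>K. prob {\<omega> \<in> space M. segment X (i + 1) (j + 1) \<omega> \<in> E} + ?c / 3 ^ K)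
        \<longlonglongrightarrow> prob {\<omega> \<in> space M. segment X (i + 1) (j + 1) \<omega> \<in> E}"
    proof -
      have "(\<lambda>K. ?c / 3 ^ K) \<longlonglongrightarrow> 0"
        by real_asymp
      then show ?thesis
        using tendsto_add[OF tendsto_const] by fastforce
    qed
    show ?thesis
      by (rule LIMSEQ_le_const[OF lim]) (use prob_segment_shift_le_add[of i j E] in auto)
  qed
  have "prob {\<omega> \<in> space M. segment X i j \<omega> \<in> - E} = 1 - prob {\<omega> \<in> space M. segment X i j \<omega> \<in> E}" for i j
    by (subst prob_compl[OF segment_event_sets, symmetric]) (auto intro!: arg_cong[where f = prob])
  then show ?thesis
    using le[of E] le[of "- E"] by simp
qed

lemma process_measurable: "(\<lambda>\<omega> i. X i \<omega>) \<in> measurable M seq_space"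
  unfolding seq_space_def by (rule measurable_PiM_single') auto

lemma shift_measurable: "shift \<in> measurable seq_space seq_space"
  unfolding seq_space_def shift_def by (rule measurable_PiM_single') auto

lemma stationary_process: "stationary M X"
proof -
  let ?Q = "distr M seq_space (\<lambda>\<omega> i. X (i + 1) \<omega>)"
  have meas: "(\<lambda>\<omega> i. X (i + 1) \<omega>) \<in> measurable M seq_space"
    unfolding seq_space_def by (rule measurable_PiM_single') auto
  have "distr (process_law M X) seq_space shift = ?Q"
    unfolding process_law_def by (subst distr_distr[OF shift_measurable process_measurable]) (simp add: comp_def shift_def)
  also have "?Q = process_law M X"
  proof (rule measure_eqI_PiM_infinite[where I = UNIV and M = "\<lambda>_. count_space UNIV"])
    fix A :: "int \<Rightarrow> bit set" and J :: "int set"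
    assume J: "finite J"
    \<comment> \<open>It is enough to compare the laws on cylinders. The window from
      \<open>- m\<close> to \<open>m\<close> covers the finitely many coordinates of a cylinder, and
      coordinate \<open>t\<close> is letter \<open>t + m\<close> of it.\<close>
    obtain m where m: "\<And>t. t \<in> J \<Longrightarrow> \<bar>t\<bar> \<le> m"
      using that[of "Max (abs ` J)"] J by simp
    let ?R = "prod_emb UNIV (\<lambda>_. count_space UNIV) J (Pi\<^sub>E J A)"
    let ?E = "{w. \<forall>t\<in>J. w ! nat (t + m) \<in> A t}"
    have R: "?R \<in> sets seq_space"
      using J unfolding seq_space_def by (intro sets_PiM_I) auto
    have seg: "segment X (- m) m \<omega> ! nat (t + m) = X t \<omega>"
      "segment X (- m + 1) (m + 1) \<omega> ! nat (t + m) = X (t + 1) \<omega>" if "t \<in> J" for t \<omega>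
    proof -
      have "0 \<le> t + m" "t \<le> m"
        using m[OF that] by linarith+
      then show "segment X (- m) m \<omega> ! nat (t + m) = X t \<omega>"
        "segment X (- m + 1) (m + 1) \<omega> ! nat (t + m) = X (t + 1) \<omega>"
        by (subst nth_segment; simp add: ac_simps)+
    qed
    have "(\<lambda>\<omega> i. X (i + 1) \<omega>) -` ?R \<inter> space M = {\<omega> \<in> space M. segment X (- m + 1) (m + 1) \<omega> \<in> ?E}"
      using seg(2) by (auto simp: prod_emb_def PiE_iff simp del: uminus_add_conv_diff)
    moreover have "(\<lambda>\<omega> i. X i \<omega>) -` ?R \<inter> space M = {\<omega> \<in> space M. segment X (- m) m \<omega> \<in> ?E}"
      by (auto simp: prod_emb_def PiE_iff seg)
    ultimately show "emeasure ?Q ?R = emeasure (process_law M X) ?R"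
      unfolding process_law_def emeasure_distr[OF meas R] emeasure_distr[OF process_measurable R]
        emeasure_eq_measure
      by (simp only: prob_segment_shift)
  qed (auto simp: process_law_def seq_space_def intro!: finite_measure_distr meas[unfolded seq_space_def])
  finally show ?thesis
    by (simp add: stationary_def)
qed

section \<open>Relative 2-fold mixing\<close>

lemma prob_straddle_le:
  "prob {\<omega> \<in> space M. (N k \<omega> + p) mod 3 ^ k + int l \<ge> 3 ^ k} \<le> l / 3 ^ k"
proof -
  let ?B = "{n. (n + p) mod 3 ^ k + int l \<ge> 3 ^ k} \<inter> {0..<3 ^ k :: int}"
  \<comment> \<open>Translation by \<open>p\<close> permutes the residues modulo
    \<open>3 ^ k\<close>, so at most \<open>l\<close> of the equally likely offsets start the window
    among the last \<open>l\<close> positions of a block.\<close>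
  have "inj_on (\<lambda>n. (n + p) mod 3 ^ k) ?B"
  proof (rule inj_onI)
    fix x y assume *: "x \<in> ?B" "y \<in> ?B" "(x + p) mod 3 ^ k = (y + p) mod 3 ^ k"
    then have "(x + p - p) mod 3 ^ k = (y + p - p) mod 3 ^ k"
      by (metis mod_diff_cong)
    then show "x = y"
      using * by simp
  qed
  moreover have "(\<lambda>n. (n + p) mod 3 ^ k) ` ?B \<subseteq> {3 ^ k - int l..<3 ^ k}"
    by auto
  ultimately have "card ?B \<le> card {3 ^ k - int l..<3 ^ k}"
    by (rule card_inj_on_le) simp
  then have "card ?B \<le> l"
    by simp
  then show ?thesis
    using prob_offset_in[of k "{n. (n + p) mod 3 ^ k + int l \<ge> 3 ^ k}"] by (simp add: divide_right_mono)
qed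

text \<open>All three conditional probabilities are computed inside one block of order
  \<open>K\<close> containing both windows, where the words read are independent as long as neither
  straddles a boundary of order \<open>k\<close>.\<close>

lemma prob_given_segment_event_pair:
  assumes p: "3 ^ k \<le> p"
  shows "AE \<omega> in M. N k \<omega> mod 3 ^ k + int l < 3 ^ k \<longrightarrow> (N k \<omega> + int p) mod 3 ^ k + int l < 3 ^ k \<longrightarrow>
    prob_given M F (segment_event M X l 0 E1 \<inter> segment_event M X l p E2) \<omega> =
    prob_given M F (segment_event M X l 0 E1) \<omega> * prob_given M F (segment_event M X l p E2) \<omega>"
proof -
  let ?C1 = "segment_event M X l 0 E1" and ?C2 = "segment_event M X l p E2"
  let ?P = "\<lambda>K n. 0 \<le> n \<and> n + int (p + l) < 3 ^ K"
  let ?W1 = "\<lambda>n. {w. take (l + 1) (drop (nat n) w) \<in> E1}"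
  let ?W2 = "\<lambda>n. {w. take (l + 1) (drop (nat (n + int p)) w) \<in> E2}"
  have C: "?C1 \<in> events" "?C2 \<in> events"
    unfolding segment_event_def by (rule segment_event_sets)+
  have seg: "segment X 0 (int l) \<omega> = take (l + 1) (drop (nat (N K \<omega>)) (block_word S X K \<omega>))"
    "segment X (int p) (int (p + l)) \<omega> = take (l + 1) (drop (nat (N K \<omega> + int p)) (block_word S X K \<omega>))"
    if "?P K (N K \<omega>)" for \<omega> K
    using that by (subst segment_eq_block_word[of S K]; force simp: nat_add_distrib)+
  have 1: "AE \<omega> in M. ?P K (N K \<omega>) \<longrightarrow> prob_given M F ?C1 \<omega> = measure (block_law K) (?W1 (N K \<omega>))" for K
    by (rule prob_given_eq_block_law[OF C(1)]) (auto simp: segment_event_def seg)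
  have 2: "AE \<omega> in M. ?P K (N K \<omega>) \<longrightarrow> prob_given M F ?C2 \<omega> = measure (block_law K) (?W2 (N K \<omega>))" for K
    by (rule prob_given_eq_block_law[OF C(2)]) (auto simp: segment_event_def seg(2)[simplified])
  have 12: "AE \<omega> in M. ?P K (N K \<omega>) \<longrightarrow>
      prob_given M F (?C1 \<inter> ?C2) \<omega> = measure (block_law K) (?W1 (N K \<omega>) \<inter> ?W2 (N K \<omega>))" for K
    by (rule prob_given_eq_block_law[OF sets.Int[OF C]]) (auto simp: segment_event_def seg(1) seg(2)[simplified])
  \<comment> \<open>The scale \<open>K\<close> chosen below depends on \<open>\<omega>\<close>, so
    one null set has to serve all scales.\<close>
  have "AE \<omega> in M. \<forall>K. ?P K (N K \<omega>) \<longrightarrow> prob_given M F ?C1 \<omega> = measure (block_law K) (?W1 (N K \<omega>))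
      \<and> prob_given M F ?C2 \<omega> = measure (block_law K) (?W2 (N K \<omega>))
      \<and> prob_given M F (?C1 \<inter> ?C2) \<omega> = measure (block_law K) (?W1 (N K \<omega>) \<inter> ?W2 (N K \<omega>))"
    unfolding AE_all_countable
  proof
    fix K
    from 1[of K] 2[of K] 12[of K] show "AE \<omega> in M. ?P K (N K \<omega>) \<longrightarrow> prob_given M F ?C1 \<omega> = measure (block_law K) (?W1 (N K \<omega>))
        \<and> prob_given M F ?C2 \<omega> = measure (block_law K) (?W2 (N K \<omega>))
        \<and> prob_given M F (?C1 \<inter> ?C2) \<omega> = measure (block_law K) (?W1 (N K \<omega>) \<inter> ?W2 (N K \<omega>))"
      by eventually_elim blast
  qed
  with AE_S AE_window show ?thesis
  proof eventually_elim
    case (elim \<omega>)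
    obtain K where K: "N K \<omega> + int (p + l) < 3 ^ K"
      using elim(2) by (meson order_refl)
    note b = block_offset_bounds[of S \<omega>, OF elim(1)[rule_format]]
    have "int p < 3 ^ K"
      using K b(1)[of K] by linarith
    then have "p < 3 ^ K"
      by simp
    with p have "(3::nat) ^ k < 3 ^ K"
      by (rule order.strict_trans1)
    then have kK: "k \<le> K"
      by simp
    have mod_k: "N K \<omega> mod 3 ^ k = N k \<omega>"
      using elim(1) kK by (intro block_offset_mod) auto
    define n where "n = nat (N K \<omega>)"
    have n: "N K \<omega> = int n"
      using b(1)[of K] by (simp add: n_def)
    show ?case
    proof (intro impI)
      assume a: "N k \<omega> mod 3 ^ k + int l < 3 ^ k" "(N k \<omega> + int p) mod 3 ^ k + int l < 3 ^ k"
      have "int (n mod 3 ^ k + l) < int (3 ^ k)"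
        using a(1) unfolding mod_k[symmetric] by (simp add: n zmod_int mod_simps)
      moreover have "int ((n + p) mod 3 ^ k + l) < int (3 ^ k)"
        using a(2) unfolding mod_k[symmetric] by (simp add: n zmod_int mod_simps)
      moreover have "int (n + p) < int (3 ^ K)"
        using K by (simp add: n)
      ultimately show "prob_given M F (?C1 \<inter> ?C2) \<omega> = prob_given M F ?C1 \<omega> * prob_given M F ?C2 \<omega>"
        using block_law_subwords_indep[of n k "n + p" K l E1 E2] elim(3)[rule_format, of K] K b(1)[of K] p kK
        by (simp add: n nat_int_add Collect_conj_eq del: of_nat_add)
    qed
  qed
qed

lemma mixing2_relative_skeleton: "mixing2_relative M X F"
  unfolding mixing2_relative_def
proof (intro allI impI)
  fix l :: nat and E1 E2 :: "bit list set"
  let ?Y = "\<lambda>p \<omega>. prob_given M F (segment_event M X l 0 E1 \<inter> segment_event M X l p E2) \<omega>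
             - prob_given M F (segment_event M X l 0 E1) \<omega> * prob_given M F (segment_event M X l p E2) \<omega>"
  have [measurable]: "prob_given M F A \<in> borel_measurable M" for A
    by (simp add: prob_given_def)
  show "tendsto_zero_in_prob M ?Y sequentially"
    unfolding tendsto_zero_in_prob_def
  proof (intro allI impI)
    fix e :: real assume e: "e > 0"
    \<comment> \<open>Off the straddling events at \<open>0\<close> and \<open>p\<close> the
      difference is almost surely \<open>0\<close>, so the bound does not involve \<open>e\<close>
      and is uniform in \<open>p\<close> from \<open>3 ^ k\<close> on.\<close>
    have le: "prob {\<omega> \<in> space M. \<bar>?Y p \<omega>\<bar> > e} \<le> 2 * real l / 3 ^ k" if "3 ^ k \<le> p" for p k
    proof -
      define B where "B q = {\<omega> \<in> space M. (N k \<omega> + q) mod 3 ^ k + int l \<ge> 3 ^ k}" for q :: int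
      have B: "B q \<in> events" for q
        using N_event[of k "{n. (n + q) mod 3 ^ k + int l \<ge> 3 ^ k}"] by (simp add: B_def)
      have "AE \<omega> in M. \<omega> \<in> {\<omega> \<in> space M. \<bar>?Y p \<omega>\<bar> > e} \<longrightarrow> \<omega> \<in> B 0 \<union> B (int p)"
        using prob_given_segment_event_pair[OF that, of l E1 E2] AE_space
        by eventually_elim (use e in \<open>auto simp: B_def\<close>)
      then have "prob {\<omega> \<in> space M. \<bar>?Y p \<omega>\<bar> > e} \<le> prob (B 0 \<union> B (int p))"
        using B by (intro finite_measure_mono_AE) auto
      also have "\<dots> \<le> prob (B 0) + prob (B (int p))"
        using B by (intro measure_Un_le)
      also have "\<dots> \<le> l / 3 ^ k + l / 3 ^ k"
        unfolding B_def by (intro add_mono prob_straddle_le)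
      finally show ?thesis
        by simp
    qed
    show "(\<lambda>p. prob {\<omega> \<in> space M. \<bar>?Y p \<omega>\<bar> > e}) \<longlonglongrightarrow> 0"
    proof (rule LIMSEQ_I)
      fix r :: real assume r: "r > 0"
      have "(\<lambda>k. 2 * real l / 3 ^ k) \<longlonglongrightarrow> 0"
        by real_asymp
      then have "\<forall>\<^sub>F k in sequentially. 2 * real l / 3 ^ k < r"
        using r by (rule order_tendstoD)
      then obtain k where "2 * real l / 3 ^ k < r"
        using eventually_happens by force
      then show "\<exists>p0. \<forall>p\<ge>p0. norm (prob {\<omega> \<in> space M. \<bar>?Y p \<omega>\<bar> > e} - 0) < r"
        using le[of k] by (intro exI[of _ "3 ^ k"]) (auto intro: le_less_trans)
    qed
  qed
qed

section \<open>Failure of relative 3-fold mixing\<close>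

lemma not_mixing3_relative_skeleton: "\<not> mixing3_relative M X F"
proof
  assume "mixing3_relative M X F"
  define A where "A p = segment_event M X 0 p {[1]}" for p
  define Y where "Y = (\<lambda>(p, q) \<omega>. prob_given M F (A 0 \<inter> A p \<inter> A (p + q)) \<omega>
    - prob_given M F (A 0) \<omega> * prob_given M F (A p) \<omega> * prob_given M F (A (p + q)) \<omega>)"
  have [measurable]: "prob_given M F A \<in> borel_measurable M" for A
    by (simp add: prob_given_def)
  have "tendsto_zero_in_prob M Y (sequentially \<times>\<^sub>F sequentially)"
    using \<open>mixing3_relative M X F\<close>[unfolded mixing3_relative_def, rule_format, of "{[1]}" 0 "{[1]}" "{[1]}"]
    by (simp add: Y_def A_def)
  then have "((\<lambda>n. prob {\<omega> \<in> space M. \<bar>Y n \<omega>\<bar> > 1 / 16}) \<longlongrightarrow> 0) (sequentially \<times>\<^sub>F sequentially)"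
    unfolding tendsto_zero_in_prob_def by (rule allE[of _ "1 / 16"]) simp
  moreover have "filterlim (\<lambda>k::nat. (3 ^ k, 3 ^ k) :: nat \<times> nat) (sequentially \<times>\<^sub>F sequentially) sequentially"
    by (intro filterlim_Pair) (auto intro!: filterlim_subseq simp: strict_mono_def)
  ultimately have "(\<lambda>k. prob {\<omega> \<in> space M. \<bar>Y (3 ^ k, 3 ^ k) \<omega>\<bar> > 1 / 16}) \<longlonglongrightarrow> 0"
    by (rule filterlim_compose)
  \<comment> \<open>With \<open>p = q = 3 ^ k\<close> and \<open>S k = 0\<close>, an event of
    probability \<open>1 / 3\<close>, the three letters hold the same position in the three thirds
    of a block. Three letters \<open>1\<close> do not sum to \<open>0\<close>, so the triple event
    has conditional probability \<open>0\<close>, while the product is \<open>1 / 8\<close>, above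
    the threshold \<open>1 / 16\<close>.\<close>
  moreover have "1 / 3 \<le> prob {\<omega> \<in> space M. \<bar>Y (3 ^ k, 3 ^ k) \<omega>\<bar> > 1 / 16}" for k
  proof -
    \<comment> \<open>At scale \<open>Suc k\<close> this says that \<open>0\<close> lies in the
      first third of its block, so that \<open>3 ^ k\<close> and \<open>2 * 3 ^ k\<close> are in the
      same block.\<close>
    let ?P = "\<lambda>n. 0 \<le> n \<and> n < 3 ^ k"
    let ?W = "\<lambda>p n. {w. take 1 (drop (nat n + p) w) \<in> {[1]}}"
    have A: "A p \<in> events" for p
      unfolding A_def segment_event_def by (rule segment_event_sets)
    have seg: "segment X (int p) (int p) \<omega> = take 1 (drop (nat (N (Suc k) \<omega>) + p) (block_word S X (Suc k) \<omega>))"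
      if "?P (N (Suc k) \<omega>)" "p \<le> 2 * 3 ^ k" for \<omega> p
    proof -
      have "int p \<le> int (2 * 3 ^ k)"
        using that by (intro of_nat_mono)
      then show ?thesis
        using that by (subst segment_eq_block_word[of S "Suc k"]) (auto simp: nat_add_distrib)
    qed
    have mem: "\<omega> \<in> A p \<longleftrightarrow> block_word S X (Suc k) \<omega> \<in> ?W p (N (Suc k) \<omega>)"
      if "\<omega> \<in> space M" "?P (N (Suc k) \<omega>)" "p \<le> 2 * 3 ^ k" for \<omega> p
      using that by (simp add: A_def segment_event_def seg)
    have 1: "AE \<omega> in M. ?P (N (Suc k) \<omega>) \<longrightarrow>
        prob_given M F (A p) \<omega> = measure (block_law (Suc k)) (?W p (N (Suc k) \<omega>))"
      if "p \<le> 2 * 3 ^ k" for p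
      using that by (intro prob_given_eq_block_law A mem)
    have 3: "AE \<omega> in M. ?P (N (Suc k) \<omega>) \<longrightarrow>
        prob_given M F (A 0 \<inter> A (3 ^ k) \<inter> A (3 ^ k + 3 ^ k)) \<omega> = measure (block_law (Suc k))
          (?W 0 (N (Suc k) \<omega>) \<inter> ?W (3 ^ k) (N (Suc k) \<omega>) \<inter> ?W (3 ^ k + 3 ^ k) (N (Suc k) \<omega>))"
    proof (intro prob_given_eq_block_law sets.Int A)
      fix \<omega> assume \<omega>: "\<omega> \<in> space M" "?P (N (Suc k) \<omega>)"
      show "\<omega> \<in> A 0 \<inter> A (3 ^ k) \<inter> A (3 ^ k + 3 ^ k) \<longleftrightarrow> block_word S X (Suc k) \<omega> \<in>
          ?W 0 (N (Suc k) \<omega>) \<inter> ?W (3 ^ k) (N (Suc k) \<omega>) \<inter> ?W (3 ^ k + 3 ^ k) (N (Suc k) \<omega>)"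
        unfolding Int_iff by (intro arg_cong2[where f = "(\<and>)"] mem \<omega>) simp_all
    qed
    have le: "0 \<le> 2 * (3::nat) ^ k" "(3::nat) ^ k \<le> 2 * 3 ^ k" "(3::nat) ^ k + 3 ^ k \<le> 2 * 3 ^ k"
      by simp_all
    have "AE \<omega> in M. \<omega> \<in> {\<omega> \<in> space M. S k \<omega> = 0} \<longrightarrow> \<omega> \<in> {\<omega> \<in> space M. \<bar>Y (3 ^ k, 3 ^ k) \<omega>\<bar> > 1 / 16}"
      using AE_S 1[OF le(1)] 1[OF le(2)] 1[OF le(3)] 3
    proof eventually_elim
      case (elim \<omega>)
      show ?case
      proof
        assume S0: "\<omega> \<in> {\<omega> \<in> space M. S k \<omega> = 0}"
        define n where "n = nat (N (Suc k) \<omega>)"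
        have P: "?P (N (Suc k) \<omega>)"
          using S0 block_offset_bounds[of S \<omega> k] elim(1) by (auto simp: block_offset_Suc)
        then have n: "n < 3 ^ k"
          by (simp add: n_def nat_less_iff)
        have half: "measure (block_law (Suc k)) {w. take 1 (drop (n + p) w) \<in> {[1]}} = 1 / 2"
          if "p \<le> 3 ^ k + 3 ^ k" for p
          using that n by (intro block_law_coordinate) simp
        have "measure (block_law (Suc k)) (?W 0 (N (Suc k) \<omega>) \<inter> ?W (3 ^ k) (N (Suc k) \<omega>) \<inter> ?W (3 ^ k + 3 ^ k) (N (Suc k) \<omega>)) = 0"
          unfolding measure_pmf_zero_iff n_def[symmetric]
        proof safe
          fix w assume w: "w \<in> set_pmf (block_law (Suc k))"
            and e: "take 1 (drop (n + 0) w) = [1]" "take 1 (drop (n + 3 ^ k) w) = [1]"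
              "take 1 (drop (n + (3 ^ k + 3 ^ k)) w) = [1]"
          have "w ! (n + p) = 1" if "take 1 (drop (n + p) w) = [1]" for p
            using that by (cases "drop (n + p) w") (auto dest: arg_cong[of _ _ hd] simp: nth_via_drop)
          from this[OF e(1)] this[OF e(2)] this[OF e(3)] show "w \<in> {}"
            using block_law_thirds_sum_0[OF w n] by (simp add: mult_2)
        qed
        then have triple: "prob_given M F (A 0 \<inter> A (3 ^ k) \<inter> A (3 ^ k + 3 ^ k)) \<omega> = 0"
          using elim(5) P by argo
        note single = elim(2)[THEN mp, OF P, THEN trans, OF half[unfolded n_def, OF le0]]
          elim(3)[THEN mp, OF P, THEN trans, OF half[unfolded n_def, OF le_add1]]
          elim(4)[THEN mp, OF P, THEN trans, OF half[unfolded n_def, OF order_refl]]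
        have "Y (3 ^ k, 3 ^ k) \<omega> = - (1 / 8)"
          unfolding Y_def prod.case triple single by simp
        then show "\<omega> \<in> {\<omega> \<in> space M. \<bar>Y (3 ^ k, 3 ^ k) \<omega>\<bar> > 1 / 16}"
          using S0 by simp
      qed
    qed
    then have "prob {\<omega> \<in> space M. S k \<omega> = 0} \<le> prob {\<omega> \<in> space M. \<bar>Y (3 ^ k, 3 ^ k) \<omega>\<bar> > 1 / 16}"
      by (intro finite_measure_mono_AE) (auto simp: Y_def)
    then show ?thesis
      by (simp add: prob_S)
  qed
  ultimately have "1 / 3 \<le> (0 :: real)"
    by (intro LIMSEQ_le_const) auto
  then show False
    by simp
qed

end

section \<open>Recovering the skeleton\<close>

lemma block_in_support:
  assumes "w \<in> set_pmf (block_law (k + r))" "a < 3 ^ r"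
  shows "block k a w \<in> set_pmf (block_law k)"
  using assms block_law_block[OF assms(2), of k] by (metis imageI set_map_pmf)

lemma nth_block:
  assumes "t < 3 ^ k" "a * 3 ^ k \<le> length w"
  shows "block k a w ! t = w ! (a * 3 ^ k + t)"
  using assms by (simp add: block_def)

lemma concat_in_support:
  "u \<in> set_pmf (block_law k) \<Longrightarrow> v \<in> set_pmf (block_law k) \<Longrightarrow>
    u @ v @ map2 (+) u v \<in> set_pmf (block_law (Suc k))"
  by (auto intro!: image_eqI[of _ _ "(u, v)"])

lemma replicate_0_in_support: "replicate (3 ^ k) 0 \<in> set_pmf (block_law k)"
proof (induction k)
  case (Suc k)
  let ?z = "replicate (3 ^ k) (0 :: bit)"
  have "replicate (3 ^ Suc k) (0 :: bit) = ?z @ ?z @ map2 (+) ?z ?z"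
    by (simp flip: replicate_add)
  then show ?case
    using concat_in_support[OF Suc Suc] by simp
qed simp

lemma ex_support_first_1: "\<exists>u\<in>set_pmf (block_law k). u ! 0 = 1"
proof (induction k)
  case (Suc k)
  then obtain u where u: "u \<in> set_pmf (block_law k)" "u ! 0 = 1"
    by blast
  have "u @ u @ map2 (+) u u \<in> set_pmf (block_law (Suc k))"
    using u(1) u(1) by (rule concat_in_support)
  moreover have "(u @ u @ map2 (+) u u) ! 0 = 1"
    using u length_block_law[OF u(1)] by (simp add: nth_append)
  ultimately show ?case
    by blast
qed simp

text \<open>The words for which the grid of \<open>(k + 1)\<close>-blocks shifted by \<open>d\<close> blocks of order \<open>k\<close> cannot be told from
  the true one by means of the first letters of the \<open>k\<close>-blocks.\<close>

definition misaligned :: "nat \<Rightarrow> nat \<Rightarrow> nat \<Rightarrow> bit list set" where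
  "misaligned k d r = {w. \<forall>a. (3 * a + d) * 3 ^ k + 2 * 3 ^ k < 3 ^ (k + r) \<longrightarrow>
     w ! ((3 * a + d) * 3 ^ k) + w ! ((3 * a + d) * 3 ^ k + 3 ^ k) + w ! ((3 * a + d) * 3 ^ k + 2 * 3 ^ k) = 0}"

text \<open>A third of order \<open>k + Suc r\<close> starts at a multiple of
  \<open>3 ^ Suc k\<close>, so the shifted grid of the whole word restricts to the grid of the third
  with the same \<open>d\<close>.\<close>

lemma misaligned_block:
  assumes w: "w \<in> misaligned k d (Suc (Suc r))" "length w = 3 ^ (k + Suc (Suc r))" and s: "s < 2"
  shows "block (k + Suc r) s w \<in> misaligned k d (Suc r)"
  unfolding misaligned_def
proof (intro CollectI allI impI)
  fix a
  let ?b = "block (k + Suc r) s w"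
  let ?m = "(3 * a + d) * 3 ^ k"
  assume a: "?m + 2 * 3 ^ k < 3 ^ (k + Suc r)"
  have s1: "s * 3 ^ (k + Suc r) \<le> 3 ^ (k + Suc r)"
    using s by (cases s) auto
  have nth: "?b ! t = w ! (s * 3 ^ (k + Suc r) + t)" if "t < 3 ^ (k + Suc r)" for t
    using that s1 by (intro nth_block) (auto simp: w(2))
  have m: "s * 3 ^ (k + Suc r) + ?m = (3 * (a + s * 3 ^ r) + d) * 3 ^ k"
    by (simp add: power_add algebra_simps)
  have "(3 * (a + s * 3 ^ r) + d) * 3 ^ k + 2 * 3 ^ k < 3 ^ (k + Suc (Suc r))"
  proof -
    have "(3::nat) ^ (k + Suc (Suc r)) = 3 * 3 ^ (k + Suc r)"
      by simp
    then show ?thesis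
      using a s1 unfolding m[symmetric] by linarith
  qed
  with w(1) have "w ! ((3 * (a + s * 3 ^ r) + d) * 3 ^ k) + w ! ((3 * (a + s * 3 ^ r) + d) * 3 ^ k + 3 ^ k)
      + w ! ((3 * (a + s * 3 ^ r) + d) * 3 ^ k + 2 * 3 ^ k) = 0"
    unfolding misaligned_def mem_Collect_eq by blast
  moreover have "?m < 3 ^ (k + Suc r)" "?m + 3 ^ k < 3 ^ (k + Suc r)"
    using a by simp_all
  ultimately show "?b ! ?m + ?b ! (?m + 3 ^ k) + ?b ! (?m + 2 * 3 ^ k) = 0"
    using a by (simp only: m[symmetric] nth add.assoc)
qed

text \<open>A misaligned word has misaligned first and second thirds, and these are independent;
  only pairs of thirds are independent, hence a square and not a cube.\<close>

lemma prob_misaligned_Suc_le: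
  "measure (block_law (k + Suc (Suc r))) (misaligned k d (Suc (Suc r)))
    \<le> (measure (block_law (k + Suc r)) (misaligned k d (Suc r)))\<^sup>2"
proof -
  let ?W = "misaligned k d (Suc r)"
  have "measure (block_law (k + Suc (Suc r))) (misaligned k d (Suc (Suc r))) \<le>
      measure (block_law (k + Suc (Suc r))) ((\<lambda>w. (block (k + Suc r) 0 w, block (k + Suc r) 1 w)) -` (?W \<times> ?W))"
  proof (rule measure_pmf.finite_measure_mono_AE)
    have "block (k + Suc r) s w \<in> ?W"
      if "w \<in> set_pmf (block_law (k + Suc (Suc r)))" "w \<in> misaligned k d (Suc (Suc r))" "s < 2" for s w
      using that(2) length_block_law[OF that(1)] that(3) by (rule misaligned_block)
    from this[of _ 0] this[of _ 1]
    show "AE w in block_law (k + Suc (Suc r)). w \<in> misaligned k d (Suc (Suc r)) \<longrightarrow>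
        w \<in> (\<lambda>w. (block (k + Suc r) 0 w, block (k + Suc r) 1 w)) -` (?W \<times> ?W)"
      unfolding AE_measure_pmf_iff vimage_eq mem_Times_iff fst_conv snd_conv by simp
  qed simp
  also have "\<dots> = measure (map_pmf (\<lambda>w. (block (k + Suc r) 0 w, block (k + Suc r) 1 w)) (block_law (Suc (k + Suc r)))) (?W \<times> ?W)"
    by (simp only: measure_map_pmf add_Suc_right)
  also have "\<dots> = measure (block_law (k + Suc r)) ?W * measure (block_law (k + Suc r)) ?W"
    by (subst thirds_law) (auto simp: measure_pmf_prob_product)
  finally show ?thesis
    by (simp add: power2_eq_square)
qed

text \<open>The word \<open>w\<close> of the support has nine \<open>k\<close>-blocks with first
  letters \<open>1,0,1,0,0,0,1,0,1\<close>, and both shifted triples \<open>0,1,0\<close> and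
  \<open>1,0,0\<close> have sum \<open>1\<close>. Order \<open>k + 2\<close> is the first to help: a
  block of order \<open>k + 1\<close> contains no full shifted triple.\<close>

lemma prob_misaligned_2_less_1:
  assumes d: "d \<in> {1, 2}"
  shows "measure (block_law (k + 2)) (misaligned k d 2) < 1"
proof -
  obtain u where u: "u \<in> set_pmf (block_law k)" "u ! 0 = 1"
    using ex_support_first_1 by blast
  define L where "L = (3::nat) ^ k"
  define z where "z = replicate L (0 :: bit)"
  define U where "U = u @ z @ map2 (+) u z"
  define V where "V = z @ z @ map2 (+) z z"
  define w where "w = U @ V @ map2 (+) U V"
  have z: "z \<in> set_pmf (block_law k)"
    unfolding z_def L_def by (rule replicate_0_in_support)
  have L: "length u = L" "length z = L" "L > 0"
    using length_block_law[OF u(1)] by (auto simp: L_def z_def)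
  have "w \<in> set_pmf (block_law (Suc (Suc k)))"
    unfolding w_def U_def V_def by (intro concat_in_support u z)
  then have w: "w \<in> set_pmf (block_law (k + 2))"
    by (simp only: add_2_eq_Suc')
  have letters: "w ! L = 0" "w ! (L + L) = 1" "w ! (L + 2 * L) = 0"
    "w ! (2 * L) = 1" "w ! (2 * L + L) = 0" "w ! (2 * L + 2 * L) = 0"
    using L u(2) by (auto simp: w_def U_def V_def nth_append z_def)
  have "w ! (d * L) + w ! (d * L + L) + w ! (d * L + 2 * L) = 1"
    using d
  proof safe
    show "w ! (1 * L) + w ! (1 * L + L) + w ! (1 * L + 2 * L) = 1"
      unfolding mult_1 letters by simp
    show "w ! (2 * L) + w ! (2 * L + L) + w ! (2 * L + 2 * L) = 1"
      unfolding letters by simp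
  qed
  moreover have "d * L + 2 * L < 9 * L"
    using d L by auto
  ultimately have "w \<notin> misaligned k d 2"
    unfolding misaligned_def by (auto simp: L_def power_add intro!: exI[of _ 0])
  then have "\<not> (AE x in block_law (k + 2). x \<in> misaligned k d 2)"
    unfolding AE_measure_pmf_iff using w by blast
  then have "measure (block_law (k + 2)) (misaligned k d 2) \<noteq> 1"
    by (subst measure_pmf.prob_eq_1) auto
  with measure_pmf.prob_le_1 show ?thesis
    by (rule le_neq_trans)
qed

text \<open>Bounding one factor of the square by the value at order \<open>k + 2\<close> gives
  geometric decay, which suffices for a limit \<open>0\<close>.\<close>

lemma prob_misaligned_le_power:
  "measure (block_law (k + Suc (Suc r))) (misaligned k d (Suc (Suc r)))
    \<le> measure (block_law (k + 2)) (misaligned k d 2) ^ Suc r"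
proof (induction r)
  case 0
  show ?case
    by (simp add: numeral_2_eq_2 del: block_law.simps)
next
  case (Suc r)
  let ?q = "measure (block_law (k + 2)) (misaligned k d 2)"
  let ?p = "measure (block_law (k + Suc (Suc r))) (misaligned k d (Suc (Suc r)))"
  have "?p \<le> ?q"
    using Suc power_decreasing[of 1 "Suc r" ?q] by (simp del: block_law.simps)
  have "measure (block_law (k + Suc (Suc (Suc r)))) (misaligned k d (Suc (Suc (Suc r)))) \<le> ?p * ?p"
    using prob_misaligned_Suc_le[of k "Suc r" d] by (simp only: power2_eq_square)
  also have "\<dots> \<le> ?q ^ Suc r * ?q"
    by (intro mult_mono Suc \<open>?p \<le> ?q\<close>) auto
  finally show ?case
    by (simp only: power_Suc mult.commute)
qed

section \<open>A shift-invariant \<sigma>-algebra of grid tests\<close>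

definition sums_vanish :: "(int \<Rightarrow> bit) \<Rightarrow> nat \<Rightarrow> int \<Rightarrow> bool" where
  "sums_vanish x k n \<longleftrightarrow>
    (\<forall>j. (j + n) mod 3 ^ Suc k = 0 \<longrightarrow> x j + x (j + 3 ^ k) + x (j + 2 * 3 ^ k) = 0)"

text \<open>Here \<open>n\<close> is a candidate offset: when it is right, the points congruent to
  \<open>- n\<close> modulo \<open>3 ^ Suc i\<close> are the left ends of the
  \<open>(i + 1)\<close>-blocks. All levels below \<open>k\<close> are tested together because one
  level is judged only once the lower ones are right.\<close>

definition offset_event :: "nat \<Rightarrow> int \<Rightarrow> (int \<Rightarrow> bit) set" where
  "offset_event k n = {x. \<forall>i<k. sums_vanish x i n}"

definition offset_algebra :: "(int \<Rightarrow> bit) measure" where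
  "offset_algebra = sigma UNIV (range (\<lambda>(k, n). offset_event k n))"

lemma sums_vanish_shift: "sums_vanish (shift x) k n \<longleftrightarrow> sums_vanish x k (n - 1)"
proof
  assume *: "sums_vanish (shift x) k n"
  show "sums_vanish x k (n - 1)"
    unfolding sums_vanish_def
  proof (intro allI impI)
    fix j :: int assume "(j + (n - 1)) mod 3 ^ Suc k = 0"
    then have "((j - 1) + n) mod 3 ^ Suc k = 0"
      by (simp add: algebra_simps)
    then have "shift x (j - 1) + shift x (j - 1 + 3 ^ k) + shift x (j - 1 + 2 * 3 ^ k) = 0"
      using *[unfolded sums_vanish_def, rule_format, of "j - 1"] by simp
    then show "x j + x (j + 3 ^ k) + x (j + 2 * 3 ^ k) = 0"
      by (simp add: shift_def algebra_simps)
  qed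
next
  assume *: "sums_vanish x k (n - 1)"
  show "sums_vanish (shift x) k n"
    unfolding sums_vanish_def
  proof (intro allI impI)
    fix j :: int assume "(j + n) mod 3 ^ Suc k = 0"
    then have "((j + 1) + (n - 1)) mod 3 ^ Suc k = 0"
      by simp
    then have "x (j + 1) + x (j + 1 + 3 ^ k) + x (j + 1 + 2 * 3 ^ k) = 0"
      using *[unfolded sums_vanish_def, rule_format, of "j + 1"] by simp
    then show "shift x j + shift x (j + 3 ^ k) + shift x (j + 2 * 3 ^ k) = 0"
      by (simp add: shift_def algebra_simps)
  qed
qed

lemma vimage_shift_offset_event: "shift -` offset_event k n = offset_event k (n - 1)"
  by (auto simp: offset_event_def sums_vanish_shift)

lemma space_seq_space: "space seq_space = UNIV"
  by (simp add: seq_space_def space_PiM)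

lemma space_offset_algebra: "space offset_algebra = UNIV"
  by (simp add: offset_algebra_def space_measure_of_conv)

lemma sets_offset_algebra: "sets offset_algebra = sigma_sets UNIV (range (\<lambda>(k, n). offset_event k n))"
  by (simp add: offset_algebra_def sets_measure_of_conv)

lemma offset_event_in_offset_algebra: "offset_event k n \<in> sets offset_algebra"
  unfolding sets_offset_algebra by (rule sigma_sets.Basic) auto

lemma offset_event_in_seq_space: "offset_event k n \<in> sets seq_space"
proof -
  have [measurable]: "(\<lambda>x. x j) \<in> measurable seq_space (count_space UNIV)" for j
    unfolding seq_space_def by measurable
  have [measurable]: "Measurable.pred seq_space (\<lambda>x. x j + x j' + x j'' = 0)" for j j' j''
  proof -
    have "Measurable.pred seq_space (\<lambda>x. \<exists>a b c. a + b + c = 0 \<and> x j = a \<and> x j' = b \<and> x j'' = c)"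
      by measurable
    then show ?thesis
      by simp
  qed
  have "{x \<in> space seq_space. \<forall>i. i < k \<longrightarrow> (\<forall>j. (j + n) mod 3 ^ Suc i = 0 \<longrightarrow>
      x j + x (j + 3 ^ i) + x (j + 2 * 3 ^ i) = 0)} \<in> sets seq_space"
    by measurable
  then show ?thesis
    by (simp add: offset_event_def sums_vanish_def space_seq_space)
qed

lemma subalgebra_offset_algebra: "subalgebra seq_space offset_algebra"
proof -
  have "range (\<lambda>(k, n). offset_event k n) \<subseteq> sets seq_space"
    using offset_event_in_seq_space by auto
  then have "sigma_sets (space seq_space) (range (\<lambda>(k, n). offset_event k n)) \<subseteq> sets seq_space"
    by (rule sets.sigma_sets_subset)
  then show ?thesis
    by (simp add: subalgebra_def space_offset_algebra space_seq_space sets_offset_algebra)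
qed

text \<open>The shift replaces \<open>n\<close> by \<open>n - 1\<close> in a generator. This is a
  bijection of the integers, so the generators are permuted, and taking preimages commutes with
  generating a \<sigma>-algebra.\<close>

lemma shift_invariant_offset_algebra: "(\<lambda>B. shift -` B) ` sets offset_algebra = sets offset_algebra"
proof -
  let ?R = "range (\<lambda>(k, n). offset_event k n)"
  have "(\<lambda>B. shift -` B) ` ?R = ?R"
  proof
    show "(\<lambda>B. shift -` B) ` ?R \<subseteq> ?R"
    proof safe
      fix k n
      show "shift -` offset_event k n \<in> ?R"
        unfolding vimage_shift_offset_event by (rule range_eqI[of _ _ "(k, n - 1)"]) simp
    qed
    show "?R \<subseteq> (\<lambda>B. shift -` B) ` ?R"
    proof safe
      fix k n
      have "offset_event k n = shift -` offset_event k (n + 1)"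
        by (simp add: vimage_shift_offset_event)
      then show "offset_event k n \<in> (\<lambda>B. shift -` B) ` ?R"
        by blast
    qed
  qed
  then have "sigma_sets UNIV {shift -` A \<inter> UNIV |A. A \<in> ?R} = sigma_sets UNIV ?R"
    by (simp add: image_def[symmetric] setcompr_eq_image)
  moreover have "{shift -` A \<inter> UNIV |A. A \<in> sigma_sets UNIV ?R} = sigma_sets UNIV {shift -` A \<inter> UNIV |A. A \<in> ?R}"
    by (rule sigma_sets_vimage_commute) auto
  ultimately show ?thesis
    by (simp add: sets_offset_algebra setcompr_eq_image)
qed

context skeleton_process
begin

section \<open>Reading the skeleton from the process\<close>

lemma AE_not_misaligned:
  "AE \<omega> in M. \<forall>k. \<forall>d\<in>{1, 2}. \<exists>r>0. block_word S X (k + r) \<omega> \<notin> misaligned k d r"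
proof -
  have "AE \<omega> in M. \<exists>r>0. block_word S X (k + r) \<omega> \<notin> misaligned k d r" if d: "d \<in> {1, 2}" for k d
  proof -
    let ?q = "measure (block_law (k + 2)) (misaligned k d 2)"
    let ?Z = "\<lambda>r. {\<omega> \<in> space M. block_word S X (k + Suc (Suc r)) \<omega> \<in> misaligned k d (Suc (Suc r))}"
    have "(\<lambda>r. ?q ^ Suc r) \<longlonglongrightarrow> 0"
      using prob_misaligned_2_less_1[OF d] by (intro LIMSEQ_Suc LIMSEQ_power_zero) simp
    moreover have "prob (?Z r) \<le> ?q ^ Suc r" for r
      unfolding prob_block_word_in by (rule prob_misaligned_le_power)
    ultimately have "AE \<omega> in M. \<exists>r. \<omega> \<notin> ?Z r"
      by (intro AE_ex_not_in_of_prob_tendsto_0) auto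
    with AE_space show ?thesis
      by eventually_elim blast
  qed
  then have "AE \<omega> in M. \<forall>d\<in>{1, 2}. \<exists>r>0. block_word S X (k + r) \<omega> \<notin> misaligned k d r" for k
    by (intro AE_finite_allI) auto
  then show ?thesis
    by (simp add: AE_all_countable)
qed

text \<open>The true grid passes every test. Conversely, induction on \<open>k\<close> recovers one
  base-3 digit at a time, since a wrong digit fails a test somewhere in a large enough
  block.\<close>

lemma AE_offset_event:
  "AE \<omega> in M. \<forall>k n. (\<lambda>i. X i \<omega>) \<in> offset_event k n \<longleftrightarrow> n mod 3 ^ k = N k \<omega>"
  using AE_S AE_window AE_block_word_support AE_not_misaligned
proof eventually_elim
  case (elim \<omega>)
  let ?x = "\<lambda>i. X i \<omega>"
  have bounds: "0 \<le> N k \<omega>" "N k \<omega> < 3 ^ k" for k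
    using block_offset_bounds[of S \<omega>] elim(1) by auto
  have N_mod: "N K \<omega> mod 3 ^ k = N k \<omega>" if "k \<le> K" for k K
    using elim(1) that by (intro block_offset_mod) auto
  \<comment> \<open>The tested letters are the first letters of the thirds of an aligned
    \<open>(i + 1)\<close>-block, whose word lies in the support.\<close>
  have right: "sums_vanish ?x i n" if n: "n mod 3 ^ k = N k \<omega>" and "i < k" for i k n
    unfolding sums_vanish_def
  proof (intro allI impI)
    fix j assume j: "(j + n) mod 3 ^ Suc i = 0"
    obtain K1 where K1: "\<And>K. K \<ge> K1 \<Longrightarrow> 0 \<le> N K \<omega> + j"
      using elim(2) by blast
    obtain K2 where K2: "\<And>K. K \<ge> K2 \<Longrightarrow> N K \<omega> + (j + 2 * 3 ^ i) < 3 ^ K"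
      using elim(2) by blast
    define r where "r = K1 + K2"
    \<comment> \<open>The summand \<open>Suc i\<close> makes the scale at least that of the tested
      block; \<open>r\<close> makes the block large enough to contain \<open>j\<close> and
      \<open>j + 2 * 3 ^ i\<close>.\<close>
    define K where "K = Suc i + r"
    have K: "0 \<le> N K \<omega> + j" "N K \<omega> + (j + 2 * 3 ^ i) < 3 ^ K"
      using K1[of K] K2[of K] by (auto simp: K_def r_def)
    define a where "a = nat (N K \<omega> + j)"
    have a: "N K \<omega> = int a - j"
      using K by (simp add: a_def)
    have "n mod 3 ^ Suc i = N (Suc i) \<omega>"
      using that N_mod[of "Suc i" k] by (metis Suc_leI le_imp_power_dvd mod_mod_cancel)
    moreover have "N K \<omega> mod 3 ^ Suc i = N (Suc i) \<omega>"
      by (rule N_mod) (simp add: K_def)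
    ultimately have "(N K \<omega> + j) mod 3 ^ Suc i = (n + j) mod 3 ^ Suc i"
      by (intro mod_add_cong) auto
    then have "int a mod int (3 ^ Suc i) = 0"
      using j by (simp add: a add.commute)
    then have "a mod 3 ^ Suc i = 0"
      by (metis of_nat_eq_0_iff zmod_int)
    then obtain b where b: "a = b * 3 ^ Suc i"
      by (metis dvd_def mod_0_imp_dvd mult.commute)
    have "int (a + 2 * 3 ^ i) < int (3 ^ K)"
      using K(2) by (simp add: a)
    then have lt: "a + 2 * 3 ^ i < 3 ^ K"
      by (simp only: of_nat_less_iff)
    have "b * 3 ^ Suc i < 3 ^ r * 3 ^ Suc i"
      using lt unfolding b K_def power_add mult.commute[of _ "3 ^ r"] by linarith
    then have b_lt: "b < 3 ^ r"
      by (simp only: mult_less_cancel2)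
    let ?w = "block_word S X K \<omega>"
    have "block (Suc i) b ?w \<in> set_pmf (block_law (Suc i))"
      unfolding K_def by (rule block_in_support[OF elim(3)[rule_format] b_lt])
    from block_law_thirds_sum_0[OF this, of 0]
    have "block (Suc i) b ?w ! 0 + block (Suc i) b ?w ! (0 + 3 ^ i) + block (Suc i) b ?w ! (0 + 2 * 3 ^ i) = 0"
      by simp
    then have "?w ! a + ?w ! (a + 3 ^ i) + ?w ! (a + 2 * 3 ^ i) = 0"
    proof -
      have "block (Suc i) b ?w ! t = ?w ! (a + t)" if "t < 3 ^ Suc i" for t
        using that lt unfolding b by (intro nth_block) (auto simp: length_block_word)
      then show ?thesis
        using \<open>block (Suc i) b ?w ! 0 + block (Suc i) b ?w ! (0 + 3 ^ i) + block (Suc i) b ?w ! (0 + 2 * 3 ^ i) = 0\<close>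
        by simp
    qed
    then show "?x j + ?x (j + 3 ^ i) + ?x (j + 2 * 3 ^ i) = 0"
      using lt by (simp add: nth_block_word a algebra_simps)
  qed
  have wrong: "n mod 3 ^ Suc k = N (Suc k) \<omega>" if n: "n mod 3 ^ k = N k \<omega>" and s: "sums_vanish ?x k n" for k n
  proof (rule ccontr)
    assume ne: "n mod 3 ^ Suc k \<noteq> N (Suc k) \<omega>"
    \<comment> \<open>This is the displacement of the candidate grid from the true one. Agreement at
      level \<open>k\<close> makes it a multiple of \<open>3 ^ k\<close> and disagreement at level
      \<open>Suc k\<close> makes it nonzero, so it is one or two \<open>k\<close>-blocks.\<close>
    define e where "e = (N (Suc k) \<omega> - n) mod 3 ^ Suc k"
    have "e mod 3 ^ k = (N (Suc k) \<omega> - n) mod 3 ^ k"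
      unfolding e_def by (rule mod_mod_cancel) (simp add: le_imp_power_dvd)
    also have "\<dots> = 0"
      using n N_mod[of k "Suc k"] mod_eq_dvd_iff[of "N (Suc k) \<omega>" "3 ^ k" n]
      by (metis dvd_imp_mod_0 lessI less_imp_le)
    finally obtain c where c: "e = 3 ^ k * c"
      by (auto elim!: dvdE dest!: mod_0_imp_dvd)
    have "0 \<le> e"
      unfolding e_def by simp
    then have "c = int (nat c)"
      unfolding c using mult_pos_neg[of "3 ^ k" c] by fastforce
    then obtain d where d: "e = int d * 3 ^ k"
      unfolding c by (metis mult.commute)
    have "e < 3 * 3 ^ k"
      unfolding e_def by simp
    then have "d < 3"
      unfolding d by simp
    moreover have "e \<noteq> 0"
      using ne bounds(2)[of "Suc k"] bounds(1)[of "Suc k"] unfolding e_def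
      by (metis mod_eq_dvd_iff mod_0_imp_dvd mod_pos_pos_trivial)
    ultimately have d12: "d \<in> {1, 2}"
      unfolding d by auto
    obtain r where r: "r > 0" "block_word S X (k + r) \<omega> \<notin> misaligned k d r"
      using elim(4) d12 by blast
    let ?K = "k + r"
    have "block_word S X ?K \<omega> \<in> misaligned k d r"
      unfolding misaligned_def
    proof (intro CollectI allI impI)
      fix a assume a: "(3 * a + d) * 3 ^ k + 2 * 3 ^ k < 3 ^ (k + r)"
      define m where "m = (3 * a + d) * 3 ^ k"
      have "(int m - N ?K \<omega> + n) mod 3 ^ Suc k = (int m - (N ?K \<omega> - n)) mod 3 ^ Suc k"
        by (simp add: algebra_simps)
      \<comment> \<open>As \<open>r > 0\<close>, the scale \<open>?K\<close> is at least
        \<open>Suc k\<close>, so the offsets at both scales agree modulo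
        \<open>3 ^ Suc k\<close>.\<close>
      also have "\<dots> = (int m - (N (Suc k) \<omega> - n)) mod 3 ^ Suc k"
        using r(1) N_mod[of "Suc k" ?K] bounds[of "Suc k"] by (intro mod_diff_cong) auto
      also have "\<dots> = (int m - e) mod 3 ^ Suc k"
        unfolding e_def by (simp add: mod_simps)
      also have "\<dots> = 0"
        unfolding d m_def by (simp add: algebra_simps)
      finally have "?x (int m - N ?K \<omega>) + ?x (int m - N ?K \<omega> + 3 ^ k) + ?x (int m - N ?K \<omega> + 2 * 3 ^ k) = 0"
        by (rule s[unfolded sums_vanish_def, rule_format])
      then show "block_word S X ?K \<omega> ! ((3 * a + d) * 3 ^ k) + block_word S X ?K \<omega> ! ((3 * a + d) * 3 ^ k + 3 ^ k)
          + block_word S X ?K \<omega> ! ((3 * a + d) * 3 ^ k + 2 * 3 ^ k) = 0"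
        using a unfolding m_def[symmetric] by (simp add: nth_block_word algebra_simps)
    qed
    then show False
      using r(2) by simp
  qed
  have "n mod 3 ^ k = N k \<omega>" if "?x \<in> offset_event k n" for k n
    using that
  proof (induction k)
    case 0
    then show ?case by (simp add: block_offset_0)
  next
    case (Suc k)
    then show ?case
      by (intro wrong) (auto simp: offset_event_def)
  qed
  then show ?case
    using right by (auto simp: offset_event_def)
qed

lemma skeleton_events_in_offset_algebra:
  assumes "A \<in> sets F"
  shows "\<exists>B\<in>sets offset_algebra. AE \<omega> in M. \<omega> \<in> A \<longleftrightarrow> (\<lambda>i. X i \<omega>) \<in> B"
proof -
  \<comment> \<open>Almost surely the only \<open>n\<close> in \<open>{0..<3 ^ Suc k}\<close> that
    passes the tests is the offset, and the third containing it is the digit \<open>S k\<close>. The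
    last branch also gives the default \<open>2\<close> to sequences for which no candidate
    passes.\<close>
  define f :: "(int \<Rightarrow> bit) \<Rightarrow> nat \<Rightarrow> nat" where
    "f x k = (if \<exists>n\<in>{0..<3 ^ k}. x \<in> offset_event (Suc k) n then 0
      else if \<exists>n\<in>{3 ^ k..<2 * 3 ^ k}. x \<in> offset_event (Suc k) n then 1 else 2)" for x k
  let ?P = "Pi\<^sub>M UNIV (\<lambda>_. count_space UNIV) :: (nat \<Rightarrow> nat) measure"
  obtain C where C: "C \<in> sets ?P" and A: "A = (\<lambda>\<omega> k. S k \<omega>) -` C \<inter> space M"
    using assms unfolding skeleton_algebra_def by (subst (asm) sets_vimage_algebra2) (auto simp: space_PiM)
  have [measurable]: "offset_event k n \<in> sets offset_algebra" for k n
    by (rule offset_event_in_offset_algebra)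
  have f: "f \<in> measurable offset_algebra ?P"
    unfolding f_def by (rule measurable_PiM_single') (auto simp: space_PiM)
  have "AE \<omega> in M. (\<lambda>k. S k \<omega>) = f (\<lambda>i. X i \<omega>)"
    using AE_S AE_offset_event
  proof eventually_elim
    case (elim \<omega>)
    have "S k \<omega> = f (\<lambda>i. X i \<omega>) k" for k
    proof -
      note b = block_offset_bounds[of S \<omega>, OF elim(1)[rule_format]]
      have ex: "(\<exists>n\<in>{u..<v}. (\<lambda>i. X i \<omega>) \<in> offset_event (Suc k) n) \<longleftrightarrow> u \<le> N (Suc k) \<omega> \<and> N (Suc k) \<omega> < v"
        if "0 \<le> u" "v \<le> 3 ^ Suc k" for u v :: int
        using that elim(2) b[of "Suc k"] by (auto intro: bexI[of _ "N (Suc k) \<omega>"])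
      have "S k \<omega> \<in> {0, 1, 2}"
        using elim(1)[rule_format, of k] by auto
      then show ?thesis
        using b[of k] unfolding f_def by (subst (1 2) ex) (auto simp: block_offset_Suc)
    qed
    then show ?case by (rule ext)
  qed
  then have "AE \<omega> in M. \<omega> \<in> A \<longleftrightarrow> (\<lambda>i. X i \<omega>) \<in> f -` C \<inter> space offset_algebra"
    using AE_space by eventually_elim (simp add: A space_offset_algebra)
  moreover have "f -` C \<inter> space offset_algebra \<in> sets offset_algebra"
    using f C by (rule measurable_sets)
  ultimately show ?thesis
    by blast
qed

text \<open>A generator corresponds to the event \<open>N k = n mod 3 ^ k\<close>, and having an
  almost sure counterpart in \<open>F\<close> survives complements and countable unions, since only
  countably many null sets are discarded.\<close>

lemma offset_algebra_events_in_skeleton: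
  assumes "B \<in> sets offset_algebra"
  shows "\<exists>A\<in>sets F. AE \<omega> in M. \<omega> \<in> A \<longleftrightarrow> (\<lambda>i. X i \<omega>) \<in> B"
  using assms unfolding sets_offset_algebra
proof (induction rule: sigma_sets.induct)
  case (Basic B)
  then obtain k n where B: "B = offset_event k n"
    by auto
  have "{\<omega> \<in> space F. N k \<omega> = n mod 3 ^ k} \<in> sets F"
    by measurable
  moreover have "AE \<omega> in M. \<omega> \<in> {\<omega> \<in> space F. N k \<omega> = n mod 3 ^ k} \<longleftrightarrow> (\<lambda>i. X i \<omega>) \<in> B"
    using AE_offset_event AE_space unfolding B by eventually_elim (auto simp: space_F)
  ultimately show ?case
    by blast
next
  case Empty
  then show ?case by (intro bexI[of _ "{}"]) auto
next
  case (Compl B)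
  then obtain A where A: "A \<in> sets F" "AE \<omega> in M. \<omega> \<in> A \<longleftrightarrow> (\<lambda>i. X i \<omega>) \<in> B"
    by blast
  have "AE \<omega> in M. \<omega> \<in> space F - A \<longleftrightarrow> (\<lambda>i. X i \<omega>) \<in> UNIV - B"
    using A(2) AE_space by eventually_elim (auto simp: space_F)
  then show ?case
    using A(1) by blast
next
  case (Union B)
  then obtain A where A: "\<And>i. A i \<in> sets F" "\<And>i :: nat. AE \<omega> in M. \<omega> \<in> A i \<longleftrightarrow> (\<lambda>i. X i \<omega>) \<in> B i"
    by metis
  have "AE \<omega> in M. \<forall>i. \<omega> \<in> A i \<longleftrightarrow> (\<lambda>i. X i \<omega>) \<in> B i"
    using A(2) by (simp add: AE_all_countable)
  then have "AE \<omega> in M. \<omega> \<in> (\<Union>i. A i) \<longleftrightarrow> (\<lambda>i. X i \<omega>) \<in> (\<Union>i. B i)"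
    by eventually_elim auto
  then show ?case
    using A(1) by (intro bexI[of _ "\<Union>i. A i"]) auto
qed

lemma factor_algebra_skeleton: "factor_algebra M X F"
  unfolding factor_algebra_def
  using subalgebra_F subalgebra_offset_algebra shift_invariant_offset_algebra
    skeleton_events_in_offset_algebra offset_algebra_events_in_skeleton
  by blast

end

theorem mainTheorem2:
  fixes M :: "'a measure" and S :: "nat \<Rightarrow> 'a \<Rightarrow> nat" and \<xi> :: "int \<Rightarrow> 'a \<Rightarrow> bit"
  assumes "skeleton_process M S \<xi>"
  shows "stationary M \<xi>
    \<and> factor_algebra M \<xi> (skeleton_algebra M S)
    \<and> mixing2_relative M \<xi> (skeleton_algebra M S)
    \<and> \<not> mixing3_relative M \<xi> (skeleton_algebra M S)"
proof -
  interpret skeleton_process M S \<xi>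
    by (fact assms)
  show ?thesis
    using stationary_process factor_algebra_skeleton mixing2_relative_skeleton
      not_mixing3_relative_skeleton by blast
qed

end
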